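(* Let $(X_i,Y_i)$, $i=1,\ldots,n$, be an i.i.d. sample from a continuous bivariate distribution with copula $C$, whose first-order partial derivatives $\dot C_1=\partial C/\partial u$ and $\dot C_2=\partial C/\partial v$ exist and are continuous on $(0,1)^2$. Let $\widehat\Phi_n$ be the empirical $W$-footrule estimator. Then, as $n\to\infty$, $$\sqrt{n}\,(\widehat\Phi_n-\Phi_C)\xrightarrow{\ d\ }\mathcal N(0,\sigma_\Phi^2),$$ where $\sigma_\Phi^2=36\,\mathrm{Var}_C(j_C(U,V))$, with $(U,V)\sim C$ and $$j_C(u,v)=(1-u-v)^+-\int_u^1 \dot C_1(s,1-s)\,\mathrm{d}s-\int_0^{1-v}\dot C_2(s,1-s)\,\mathrm{d}s,\qquad (u,v)\in[0,1]^2.$$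
   Context: A (bivariate) copula $C$ is a distribution function on $[0,1]^2$ with uniform marginals. "Continuous bivariate distribution with copula $C$" means that the marginal distribution functions $F,G$ are continuous and the joint distribution function is $H(x,y)=C(F(x),G(y))$. Write $x^+=\max(x,0)$. $W$-footrule coefficient: $\Phi_C = 3\int_0^1\int_0^1 |1-u-v|\,\mathrm{d}C(u,v) - 1$, equivalently $\Phi_C = 6\int_0^1 C(u,1-u)\,\mathrm{d}u-1$. Estimator: let $R_i$ be the rank of $X_i$ among $X_1,\ldots,X_n$ and $S_i$ the rank of $Y_i$ among $Y_1,\ldots,Y_n$; put $\hat U_i=R_i/(n+1)$, $\hat V_i=S_i/(n+1)$, and $$\widehat\Phi_n=\frac{6}{n}\sum_{i=1}^n (1-\hat U_i-\hat V_i)^+-1=\frac{6}{n(n+1)}\sum_{i=1}^n (n+1-R_i-S_i)^+-1.$$ *)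

theory Defs
  imports "HOL-Probability.Probability"
begin

text \<open>
  A copula is represented by a curried function of which only the values on the closed unit square
  matter. It has to be the distribution function of a probability measure on the unit square with
  uniform marginals; that measure is unique (lemma \<open>copula_law_unique\<close>).
\<close>

definition copula_law :: "(real \<Rightarrow> real \<Rightarrow> real) \<Rightarrow> (real \<times> real) measure \<Rightarrow> bool" where
  "copula_law C \<mu> \<longleftrightarrow>
     prob_space \<mu> \<and>
     sets \<mu> = sets (restrict_space borel ({0..1} \<times> {0..1})) \<and>
     (\<forall>u\<in>{0..1}. \<forall>v\<in>{0..1}. C u v = measure \<mu> ({0..u} \<times> {0..v}))"

definition copula :: "(real \<Rightarrow> real \<Rightarrow> real) \<Rightarrow> bool" where
  "copula C \<longleftrightarrow>
     (\<exists>\<mu>. copula_law C \<mu>) \<and> (\<forall>u\<in>{0..1}. C u 1 = u) \<and> (\<forall>v\<in>{0..1}. C 1 v = v)"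

definition copula_measure :: "(real \<Rightarrow> real \<Rightarrow> real) \<Rightarrow> (real \<times> real) measure" where
  "copula_measure C = (THE \<mu>. copula_law C \<mu>)"

lemma copula_law_unique:
  assumes "copula_law C \<mu>" "copula_law C \<nu>"
  shows "\<mu> = \<nu>"
proof -
  let ?S = "{0..1} \<times> {0..1} :: (real \<times> real) set"
  have S: "?S \<in> sets borel"
    by (intro borel_closed closed_Times) auto
  have basic: "prob_space \<rho>" "sets \<rho> = sets (restrict_space borel ?S)" "space \<rho> = ?S"
    "(\<lambda>x. x) \<in> measurable \<rho> borel"
    "\<And>u v. u \<in> {0..1} \<Longrightarrow> v \<in> {0..1} \<Longrightarrow> measure \<rho> ({0..u} \<times> {0..v}) = C u v"
    if "copula_law C \<rho>" for \<rho>
  proof -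
    show "prob_space \<rho>" and s: "sets \<rho> = sets (restrict_space borel ?S)"
      using that by (auto simp: copula_law_def)
    show "space \<rho> = ?S"
      using sets_eq_imp_space_eq[OF s] by (simp add: space_restrict_space)
    show "(\<lambda>x. x) \<in> measurable \<rho> borel"
      unfolding measurable_cong_sets[OF s refl] by (rule measurable_restrict_space1) simp
    show "\<And>u v. u \<in> {0..1} \<Longrightarrow> v \<in> {0..1} \<Longrightarrow> measure \<rho> ({0..u} \<times> {0..v}) = C u v"
      using that by (auto simp: copula_law_def)
  qed
  have val: "measure (distr \<rho> borel (\<lambda>x. x)) {..(a, b)} =
      (if 0 \<le> a \<and> 0 \<le> b then C (min a 1) (min b 1) else 0)"
    if "copula_law C \<rho>" for \<rho> a b
  proof -
    note B = basic[OF that]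
    have "measure (distr \<rho> borel (\<lambda>x. x)) {..(a, b)} = measure \<rho> ({..(a, b)} \<inter> ?S)"
      by (subst measure_distr) (use B in auto)
    also have "{..(a, b)} \<inter> ?S = (if 0 \<le> a \<and> 0 \<le> b then {0..min a 1} \<times> {0..min b 1} else {})"
      by auto
    finally show ?thesis
      using B(5)[of "min a 1" "min b 1"] by auto
  qed
  have eq: "distr \<mu> borel (\<lambda>x. x) = distr \<nu> borel (\<lambda>x. x)"
  proof (rule measure_eqI_generator_eq[where \<Omega>=UNIV and E="range (\<lambda>a. {..a})"
        and A="\<lambda>n. {..(real n, real n)}"])
    interpret m: prob_space "distr \<mu> borel (\<lambda>x. x)"
      by (intro prob_space.prob_space_distr basic assms)
    interpret n: prob_space "distr \<nu> borel (\<lambda>x. x)"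
      by (intro prob_space.prob_space_distr basic assms)
    show "Int_stable (range (\<lambda>a::real \<times> real. {..a}))"
    proof (rule Int_stableI)
      fix A B :: "(real \<times> real) set"
      assume "A \<in> range (\<lambda>a. {..a})" "B \<in> range (\<lambda>a. {..a})"
      then obtain a b where ab: "A = {..a}" "B = {..b}" by auto
      have "A \<inter> B = {..inf a b}" unfolding ab by auto
      then show "A \<inter> B \<in> range (\<lambda>a. {..a})" by blast
    qed
    show "emeasure (distr \<mu> borel (\<lambda>x. x)) X = emeasure (distr \<nu> borel (\<lambda>x. x)) X"
      if X: "X \<in> range (\<lambda>a. {..a})" for X
    proof -
      obtain a b where "X = {..(a, b)}" using X by force
      then show ?thesis
        unfolding m.emeasure_eq_measure n.emeasure_eq_measure
        using val[OF assms(1), of a b] val[OF assms(2), of a b] by simp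
    qed
    show "sets (distr \<mu> borel (\<lambda>x. x)) = sigma_sets UNIV (range (\<lambda>a. {..a}))"
      "sets (distr \<nu> borel (\<lambda>x. x)) = sigma_sets UNIV (range (\<lambda>a. {..a}))"
      by (simp_all add: borel_eq_atMost)
    show "emeasure (distr \<mu> borel (\<lambda>x. x)) {..(real n, real n)} \<noteq> \<infinity>" for n
      by (rule m.emeasure_finite[unfolded infinity_ennreal_def[symmetric]])
    show "(\<Union>n. {..(real n, real n)}) = UNIV"
    proof (intro set_eqI iffI UNIV_I)
      fix x :: "real \<times> real"
      obtain n where "max (fst x) (snd x) \<le> real n" using real_arch_simple by blast
      then have "x \<in> {..(real n, real n)}" by (cases x) auto
      then show "x \<in> (\<Union>n. {..(real n, real n)})" by blast
    qed
  qed auto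
  show ?thesis
  proof (rule measure_eqI)
    show "sets \<mu> = sets \<nu>" using basic(2)[OF assms(1)] basic(2)[OF assms(2)] by simp
    fix A assume A: "A \<in> sets \<mu>"
    then have A': "A \<in> sets borel" "A \<subseteq> ?S"
      using S basic(2)[OF assms(1)] by (auto simp: sets_restrict_space_iff)
    have *: "emeasure (distr \<rho> borel (\<lambda>x. x)) A = emeasure \<rho> A" if "copula_law C \<rho>" for \<rho>
      using A' basic[OF that] by (subst emeasure_distr) (auto simp: Int_absorb2)
    show "emeasure \<mu> A = emeasure \<nu> A"
      using *[OF assms(1)] *[OF assms(2)] eq by simp
  qed
qed

lemma copula_law_copula_measure: "copula C \<Longrightarrow> copula_law C (copula_measure C)"
  unfolding copula_def copula_measure_def by (metis copula_law_unique theI)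

definition partial1 :: "(real \<Rightarrow> real \<Rightarrow> real) \<Rightarrow> real \<Rightarrow> real \<Rightarrow> real" where
  "partial1 C u v = deriv (\<lambda>s. C s v) u"

definition partial2 :: "(real \<Rightarrow> real \<Rightarrow> real) \<Rightarrow> real \<Rightarrow> real \<Rightarrow> real" where
  "partial2 C u v = deriv (\<lambda>t. C u t) v"

definition has_continuous_partials :: "(real \<Rightarrow> real \<Rightarrow> real) \<Rightarrow> bool" where
  "has_continuous_partials C \<longleftrightarrow>
     (\<forall>u\<in>{0<..<1}. \<forall>v\<in>{0<..<1}.
        (\<lambda>s. C s v) differentiable (at u) \<and> (\<lambda>t. C u t) differentiable (at v)) \<and>
     continuous_on ({0<..<1} \<times> {0<..<1}) (\<lambda>(u, v). partial1 C u v) \<and>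
     continuous_on ({0<..<1} \<times> {0<..<1}) (\<lambda>(u, v). partial2 C u v)"

definition continuous_law_with_copula ::
    "(real \<times> real) measure \<Rightarrow> (real \<Rightarrow> real \<Rightarrow> real) \<Rightarrow> bool" where
  "continuous_law_with_copula D C \<longleftrightarrow>
     (let F = cdf (distr D borel fst); G = cdf (distr D borel snd) in
      continuous_on UNIV F \<and> continuous_on UNIV G \<and>
      (\<forall>x y. measure D ({..x} \<times> {..y}) = C (F x) (G y)))"

definition W_footrule :: "(real \<Rightarrow> real \<Rightarrow> real) \<Rightarrow> real" where
  "W_footrule C = 3 * (\<integral>(u, v). \<bar>1 - u - v\<bar> \<partial>copula_measure C) - 1"

definition sample_rank :: "(nat \<Rightarrow> real) \<Rightarrow> nat \<Rightarrow> nat \<Rightarrow> nat" where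
  "sample_rank x n i = card {k \<in> {1..n}. x k \<le> x i}"

definition pseudo_obs :: "(nat \<Rightarrow> real) \<Rightarrow> nat \<Rightarrow> nat \<Rightarrow> real" where
  "pseudo_obs x n i = real (sample_rank x n i) / (real n + 1)"

definition W_footrule_est :: "(nat \<Rightarrow> real) \<Rightarrow> (nat \<Rightarrow> real) \<Rightarrow> nat \<Rightarrow> real" where
  "W_footrule_est x y n =
     6 / real n * (\<Sum>i=1..n. max (1 - pseudo_obs x n i - pseudo_obs y n i) 0) - 1"

text \<open>
  The partial derivatives are only meaningful on the open unit square; interval integrals do not
  depend on the endpoints.
\<close>

definition j_fun :: "(real \<Rightarrow> real \<Rightarrow> real) \<Rightarrow> real \<Rightarrow> real \<Rightarrow> real" where
  "j_fun C u v =
     max (1 - u - v) 0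
     - (LBINT s=ereal u..ereal 1. partial1 C s (1 - s))
     - (LBINT s=ereal 0..ereal (1 - v). partial2 C s (1 - s))"

definition W_footrule_avar :: "(real \<Rightarrow> real \<Rightarrow> real) \<Rightarrow> real" where
  "W_footrule_avar C = 36 * prob_space.variance (copula_measure C) (\<lambda>(u, v). j_fun C u v)"

text \<open>
  The normal law in terms of mean and variance. The library's \<open>normal_density\<close> does not cover
  variance 0, where the law is the point mass at the mean.
\<close>

definition normal_law :: "real \<Rightarrow> real \<Rightarrow> real measure" where
  "normal_law m v =
     (if v = 0 then return borel m else density lborel (normal_density m (sqrt v)))"

end

theory Submission
  imports Defs "HOL-Real_Asymp.Real_Asymp"
begin

text \<open>
  Integrating over the level \<open>s\<close> of the anti-diagonal, \<open>(1 - u - v)\<^sup>+\<close> is the integral of the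
  indicator of \<open>u \<le> s \<and> v \<le> 1 - s\<close>. Hence the centred estimator is the integral over \<open>s\<close> of the
  empirical copula at \<open>(s, 1 - s)\<close>, and it suffices to linearize the latter at each fixed \<open>s\<close>:
  the linear part integrates to an i.i.d. sum of influence functions, to which the central limit
  theorem applies, and the remainder, scaled by \<open>sqrt n\<close>, tends to 0 in mean for each \<open>s\<close> and is
  bounded in mean uniformly in \<open>s\<close>, so that its integral tends to 0 by dominated convergence.

  At a fixed level no uniform empirical process theory is needed. Sets of observations cut out by
  ranks and by values are both lower sets of the same order, hence nested, so a set cut out by
  ranks may be exchanged for any value threshold that captures nearly the right number of points.
  The threshold \<open>s + x / sqrt n\<close> does so when \<open>- x\<close> is close to the empirical process at \<open>s\<close>, and as the
  latter is bounded in probability, \<open>x\<close> can be taken from a finite mesh not depending on \<open>n\<close>.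
  At each of the finitely many mesh points the increment of the empirical process has variance of
  order \<open>1 / sqrt n\<close>, and the increment of \<open>C\<close> is given by its total derivative.
\<close>

subsection \<open>Ranks and lower sets\<close>

text \<open>The sign in \<open>- x\<close> comes from counting. A rank cut at level \<open>s\<close>
  contains \<open>n * s\<close> observations up to 1, whereas the value cut
  \<open>F (X i \<omega>) \<le> s + x / sqrt n\<close> contains about
  \<open>n * s + sqrt n * (x + W)\<close>, where \<open>W\<close> is the empirical process at
  \<open>s\<close>. The counts agree for \<open>x = - W\<close>, and the increment of
  \<open>C\<close> over this shift is the source of the negative derivative terms in
  \<open>j_fun\<close>. The obstacle is that the derivatives are continuous only inside the square,
  so the expansion of \<open>C\<close> need not be uniform as \<open>s\<close> tends to 0 or 1.
  Fixing \<open>s\<close> avoids any uniformity, and the domination in \<open>s\<close> comes from a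
  cruder bound that uses of the derivatives only that they lie between 0 and 1. All errors are
  measured in mean rather than in probability, because means pass through the integral over
  \<open>s\<close> by Fubini's theorem and bound differences of characteristic functions
  directly.\<close>

text \<open>Lower sets of a common linear preorder are nested, so \<open>A\<close> and
  \<open>B\<close> differ in exactly as many points as their cardinalities do, and likewise
  \<open>A'\<close> and \<open>B'\<close>. Only counts then matter: cuts of nearly equal size are
  interchangeable, in whatever way they were defined.\<close>

lemma card_Int_lower_sets:
  fixes x y :: "nat \<Rightarrow> real"
  assumes fin: "finite K"
    and A: "A \<subseteq> K" "\<And>i k. i \<in> A \<Longrightarrow> k \<in> K \<Longrightarrow> x k \<le> x i \<Longrightarrow> k \<in> A"
    and B: "B \<subseteq> K" "\<And>i k. i \<in> B \<Longrightarrow> k \<in> K \<Longrightarrow> x k \<le> x i \<Longrightarrow> k \<in> B"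
    and A': "A' \<subseteq> K" "\<And>i k. i \<in> A' \<Longrightarrow> k \<in> K \<Longrightarrow> y k \<le> y i \<Longrightarrow> k \<in> A'"
    and B': "B' \<subseteq> K" "\<And>i k. i \<in> B' \<Longrightarrow> k \<in> K \<Longrightarrow> y k \<le> y i \<Longrightarrow> k \<in> B'"
  shows "\<bar>real (card (A \<inter> A')) - real (card (B \<inter> B'))\<bar>
    \<le> \<bar>real (card A) - real (card B)\<bar> + \<bar>real (card A') - real (card B')\<bar>"
proof -
  have diff: "real (card (S - T)) \<le> \<bar>real (card S) - real (card T)\<bar>"
    if "S \<subseteq> K" "T \<subseteq> K" "S \<subseteq> T \<or> T \<subseteq> S" for S T
    using that fin by (auto simp: card_Diff_subset finite_subset card_mono of_nat_diff Diff_eq_empty_iff[THEN iffD2])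
  have nested: "S \<subseteq> T \<or> T \<subseteq> S"
    if "S \<subseteq> K" "\<And>i k. i \<in> S \<Longrightarrow> k \<in> K \<Longrightarrow> z k \<le> z i \<Longrightarrow> k \<in> S"
      "T \<subseteq> K" "\<And>i k. i \<in> T \<Longrightarrow> k \<in> K \<Longrightarrow> z k \<le> z i \<Longrightarrow> k \<in> T"
    for S T and z :: "nat \<Rightarrow> real"
    using that by (meson linear subset_iff)
  have AB: "A \<subseteq> B \<or> B \<subseteq> A" using nested[of A x B] A B by blast
  have AB': "A' \<subseteq> B' \<or> B' \<subseteq> A'" using nested[of A' y B'] A' B' by blast
  have one: "real (card (S \<inter> S')) \<le> real (card (T \<inter> T')) + real (card (S - T)) + real (card (S' - T'))"
    if "S \<subseteq> K" "T \<subseteq> K" "S' \<subseteq> K" "T' \<subseteq> K" for S T S' T'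
  proof -
    have "card (S \<inter> S') \<le> card ((T \<inter> T') \<union> (S - T) \<union> (S' - T'))"
      using that fin by (intro card_mono) (auto simp: finite_subset)
    also have "\<dots> \<le> card (T \<inter> T') + card (S - T) + card (S' - T')"
      by (meson add_le_mono card_Un_le le_refl le_trans)
    finally show ?thesis by linarith
  qed
  have "real (card (A \<inter> A')) \<le> real (card (B \<inter> B')) + real (card (A - B)) + real (card (A' - B'))"
    "real (card (B \<inter> B')) \<le> real (card (A \<inter> A')) + real (card (B - A)) + real (card (B' - A'))"
    using one A(1) B(1) A'(1) B'(1) by blast+
  moreover have "real (card (A - B)) \<le> \<bar>real (card A) - real (card B)\<bar>"
    "real (card (B - A)) \<le> \<bar>real (card A) - real (card B)\<bar>"
    "real (card (A' - B')) \<le> \<bar>real (card A') - real (card B')\<bar>"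
    "real (card (B' - A')) \<le> \<bar>real (card A') - real (card B')\<bar>"
    using diff[of A B] diff[of B A] diff[of A' B'] diff[of B' A'] AB AB' A(1) B(1) A'(1) B'(1)
    by (auto simp: abs_minus_commute)
  ultimately show ?thesis by linarith
qed

lemma sample_rank_mono: "x k \<le> x i \<Longrightarrow> sample_rank x n k \<le> sample_rank x n i"
  unfolding sample_rank_def by (intro card_mono) auto

text \<open>Strict monotonicity makes the rank an injective self-map of \<open>{1..n}\<close>, hence
  a permutation. This is what fixes the size of a rank cut independently of the data.\<close>

lemma bij_betw_sample_rank:
  assumes "inj_on x {1..n}"
  shows "bij_betw (sample_rank x n) {1..n} {1..n}"
proof -
  have less: "sample_rank x n k < sample_rank x n i" if "i \<in> {1..n}" "x k < x i" for i k
  proof -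
    have "{j \<in> {1..n}. x j \<le> x k} \<subseteq> {j \<in> {1..n}. x j \<le> x i}" using that by auto
    moreover have "i \<in> {j \<in> {1..n}. x j \<le> x i}" "i \<notin> {j \<in> {1..n}. x j \<le> x k}" using that by auto
    ultimately show ?thesis unfolding sample_rank_def by (intro psubset_card_mono) auto
  qed
  have inj: "inj_on (sample_rank x n) {1..n}"
  proof (rule inj_onI)
    fix i k assume ik: "i \<in> {1..n}" "k \<in> {1..n}" "sample_rank x n i = sample_rank x n k"
    then have "x i = x k" using less[of i k] less[of k i] by (metis less_irrefl linorder_neqE)
    then show "i = k" using assms ik by (auto dest: inj_onD)
  qed
  have "sample_rank x n ` {1..n} \<subseteq> {1..n}"
  proof
    fix r assume "r \<in> sample_rank x n ` {1..n}"
    then obtain i where i: "i \<in> {1..n}" "r = card {k \<in> {1..n}. x k \<le> x i}"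
      by (auto simp: sample_rank_def)
    have "{k \<in> {1..n}. x k \<le> x i} \<noteq> {}" using i by auto
    then have "r > 0" using i by (simp add: card_gt_0_iff)
    moreover have "r \<le> card {1..n}" unfolding i(2) by (intro card_mono) auto
    ultimately show "r \<in> {1..n}" by simp
  qed
  then show ?thesis
    using inj by (simp add: bij_betw_def endo_inj_surj)
qed

text \<open>The count equals \<open>m\<close>, the integer part of \<open>(n + 1) * s\<close>,
  whatever the data. Since \<open>m - n * s\<close> lies between \<open>s - 1\<close> and
  \<open>s\<close>, the denominator \<open>n + 1\<close> of the pseudo-observations costs less than
  one observation.\<close>

lemma card_pseudo_obs_le:
  assumes inj: "inj_on x {1..n}" and s: "0 < s" "s < 1" and n: "n > 0"
  shows "\<bar>real (card {i \<in> {1..n}. pseudo_obs x n i \<le> s}) / real n - s\<bar> \<le> 1 / real n"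
proof -
  define m where "m = nat \<lfloor>(real n + 1) * s\<rfloor>"
  have m: "real m \<le> (real n + 1) * s" "(real n + 1) * s < real m + 1"
    using s unfolding m_def by (auto simp: le_nat_floor)
  \<comment> \<open>\<open>s < 1\<close> keeps \<open>m\<close> within the range of the ranks, so
    the count is not truncated at \<open>n\<close>.\<close>
  have "(real n + 1) * s < real n + 1"
    using s n by simp
  with m have "m \<le> n" by linarith
  have le: "pseudo_obs x n i \<le> s \<longleftrightarrow> sample_rank x n i \<le> m" for i
  proof -
    have "pseudo_obs x n i \<le> s \<longleftrightarrow> real (sample_rank x n i) \<le> (real n + 1) * s"
      by (simp add: pseudo_obs_def divide_le_eq mult.commute)
    also have "\<dots> \<longleftrightarrow> sample_rank x n i \<le> m" using m by linarith
    finally show ?thesis .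
  qed
  have "bij_betw (sample_rank x n) {i \<in> {1..n}. sample_rank x n i \<le> m} {r \<in> {1..n}. r \<le> m}"
  proof (rule bij_betw_subset[OF bij_betw_sample_rank[OF inj]])
    have *: "f ` {i \<in> A. f i \<le> m} = {r \<in> f ` A. r \<le> m}" for f :: "nat \<Rightarrow> nat" and A
      by blast
    show "sample_rank x n ` {i \<in> {1..n}. sample_rank x n i \<le> m} = {r \<in> {1..n}. r \<le> m}"
      using *[of "sample_rank x n" "{1..n}"]
      unfolding bij_betw_imp_surj_on[OF bij_betw_sample_rank[OF inj]] .
  qed auto
  from bij_betw_same_card[OF this]
  have "card {i \<in> {1..n}. pseudo_obs x n i \<le> s} = card {r \<in> {1..n}. r \<le> m}" by (simp add: le)
  also have "{r \<in> {1..n}. r \<le> m} = {1..m}" using \<open>m \<le> n\<close> by auto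
  finally have card: "card {i \<in> {1..n}. pseudo_obs x n i \<le> s} = m" by simp
  have "\<bar>real m - real n * s\<bar> \<le> 1" 
  proof -
    have "(real n + 1) * s = real n * s + s" by (simp add: distrib_right)
    then show ?thesis using m s by linarith
  qed
  then have "\<bar>real m - real n * s\<bar> / real n \<le> 1 / real n" using n by (intro divide_right_mono) auto
  moreover have "real m / real n - s = (real m - real n * s) / real n"
    using n by (simp add: diff_divide_distrib)
  ultimately show ?thesis unfolding card by simp
qed

subsection \<open>Probabilistic preliminaries\<close>

text \<open>Continuity closes the sublevel set, so its supremum \<open>a\<close> belongs to it, and
  the intermediate value theorem gives a point of height \<open>u\<close> below which
  \<open>a\<close> cannot fall. Rectangles in the unit square thereby pull back to quadrants. At
  level 0 the set can be empty, at level 1 it is the whole line.\<close>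

lemma (in real_distribution) continuous_cdf_level:
  assumes cont: "continuous_on UNIV (cdf M)" and u: "0 < u" "u < 1"
  obtains a where "cdf M a = u" "{x. cdf M x \<le> u} = {..a}"
proof -
  define S where "S = {x. cdf M x \<le> u}"
  have "eventually (\<lambda>x. cdf M x < u) at_bot"
    using order_tendstoD(2)[OF cdf_lim_at_bot u(1)] .
  then obtain l where l: "cdf M l < u" unfolding eventually_at_bot_linorder by auto
  have "eventually (\<lambda>x. cdf M x > u) at_top"
    using order_tendstoD(1)[OF cdf_lim_at_top_prob u(2)] .
  then obtain h where h: "cdf M h > u" unfolding eventually_at_top_linorder by auto
  have bdd: "bdd_above S"
    using h cdf_nondecreasing unfolding S_def bdd_above_def
    by (metis linear mem_Collect_eq not_less order_trans)
  have ne: "S \<noteq> {}" using l by (auto simp: S_def intro: less_imp_le)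
  have closed: "closed S"
    unfolding S_def by (intro closed_Collect_le cont continuous_on_const)
  define a where "a = Sup S"
  have aS: "a \<in> S" unfolding a_def by (rule closed_contains_Sup[OF ne bdd closed])
  have eq: "S = {..a}"
  proof (intro equalityI subsetI)
    fix x assume "x \<in> S" then show "x \<in> {..a}" unfolding a_def using bdd by (auto intro: cSup_upper)
  next
    fix x assume "x \<in> {..a}"
    then have "cdf M x \<le> cdf M a" by (intro cdf_nondecreasing) auto
    with aS show "x \<in> S" by (simp add: S_def)
  qed
  have "isCont (cdf M) x" for x
    using cont by (simp add: continuous_on_eq_continuous_at)
  moreover have "l < h" using l h cdf_nondecreasing[of h l] by linarith
  ultimately obtain z where z: "cdf M z = u"
    using IVT[of "cdf M" l u h] l h by auto
  have "z \<in> S" by (simp add: S_def z)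
  then have "u \<le> cdf M a" using cdf_nondecreasing[of z a] eq z by auto
  then have "cdf M a = u" using aS by (simp add: S_def)
  then show ?thesis using that eq by (simp add: S_def)
qed

text \<open>This is the probability integral transform. Level 0, where the sublevel set may be
  empty, is squeezed by small positive levels.\<close>

lemma (in real_distribution) measure_cdf_le:
  assumes cont: "continuous_on UNIV (cdf M)" and u: "0 \<le> u" "u \<le> 1"
  shows "measure M {x. cdf M x \<le> u} = u"
proof -
  have closed: "closed {x. cdf M x \<le> v}" for v
    by (intro closed_Collect_le cont continuous_on_const)
  have open01: "measure M {x. cdf M x \<le> v} = v" if v: "0 < v" "v < 1" for v
  proof -
    obtain a where "cdf M a = v" "{x. cdf M x \<le> v} = {..a}"
      using continuous_cdf_level[OF cont v] .
    then show ?thesis by (simp add: cdf_def)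
  qed
  consider "0 < u" "u < 1" | "u = 0" | "u = 1" using u by linarith
  then show ?thesis
  proof cases
    case 2
    have "measure M {x. cdf M x \<le> 0} \<le> 0 + e" if "e > 0" for e :: real
    proof -
      \<comment> \<open>The cap \<open>1/2\<close> keeps the comparison level below 1.\<close>
      define v where "v = min e (1/2)"
      have "measure M {x. cdf M x \<le> 0} \<le> measure M {x. cdf M x \<le> v}"
        using that closed[of v] by (intro finite_measure_mono) (auto simp: v_def simp del: min_le_iff_disj min.bounded_iff min_less_iff_conj)
      also have "\<dots> = v" using that by (intro open01) (auto simp: v_def)
      finally show ?thesis by (simp add: v_def)
    qed
    then have "measure M {x. cdf M x \<le> 0} \<le> 0" by (rule field_le_epsilon)
    then show ?thesis using 2 by (simp add: measure_le_0_iff)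
  next
    case 3
    have "{x. cdf M x \<le> 1} = space M" using cdf_bounded_prob by auto
    then show ?thesis using 3 prob_space by simp
  qed (use open01 in simp)
qed

section \<open>Normal laws, weak convergence and the central limit theorem\<close>

lemma real_distribution_normal_law: "0 \<le> v \<Longrightarrow> real_distribution (normal_law m v)"
  unfolding normal_law_def real_distribution_def real_distribution_axioms_def
  by (auto intro!: prob_space_return prob_space_normal_density)

text \<open>For \<open>v > 0\<close> the law is the image of the standard normal law under
  multiplication by \<open>sqrt v\<close>; the resulting formula also takes the correct value 1 at
  the point mass \<open>v = 0\<close>.\<close>

lemma char_normal_law:
  assumes "0 \<le> v"
  shows "char (normal_law 0 v) t = exp (- (v * t\<^sup>2) / 2)"
proof (cases "v = 0")
  case True
  then show ?thesis by (simp add: normal_law_def char_def integral_return)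
next
  case False
  with assms have v: "0 < v" by simp
  interpret N: prob_space std_normal_distribution
    by (rule real_distribution.axioms[OF real_dist_normal_dist])
  have "distributed std_normal_distribution lborel (\<lambda>x. x) (normal_density 0 1)"
    by (auto simp: distributed_def distr_id2)
  from N.normal_density_affine[OF this, of "sqrt v" 0] v
  have "distributed std_normal_distribution lborel (\<lambda>x. sqrt v * x) (normal_density 0 (sqrt v))"
    by simp
  then have "normal_law 0 v = distr std_normal_distribution lborel (\<lambda>x. sqrt v * x)"
    using v by (simp add: normal_law_def distributed_def)
  then have "char (normal_law 0 v) t = char std_normal_distribution (t * sqrt v)"
    unfolding char_def by (simp add: integral_distr mult.assoc)
  also have "\<dots> = exp (- (v * t\<^sup>2) / 2)"
    using v by (simp add: char_std_normal_distribution power_mult_distrib mult.commute)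
  finally show ?thesis .
qed

lemma norm_iexp_diff_le: "cmod (iexp a - iexp b) \<le> \<bar>a - b\<bar>"
proof -
  have "iexp a - iexp b = iexp b * (iexp (a - b) - 1)"
    by (simp add: right_diff_distrib exp_add[symmetric])
  then have "cmod (iexp a - iexp b) = cmod (iexp (a - b) - 1)"
    by (simp add: norm_mult)
  also have "\<dots> \<le> \<bar>a - b\<bar>"
    using iexp_approx1[of "a - b" 0] by simp
  finally show ?thesis .
qed

text \<open>A Slutsky argument through characteristic functions: \<open>iexp\<close> is 1-Lipschitz,
  so those of \<open>A n\<close> and \<open>B n\<close> at \<open>t\<close> differ by at most
  \<open>\<bar>t\<bar>\<close> times the mean distance, and Levy continuity concludes.\<close>

lemma (in prob_space) weak_conv_m_cong_L1:
  fixes A B :: "nat \<Rightarrow> 'a \<Rightarrow> real"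
  assumes [measurable]: "\<And>n. random_variable borel (A n)" "\<And>n. random_variable borel (B n)"
    and \<nu>: "real_distribution \<nu>"
    and conv: "weak_conv_m (\<lambda>n. distr M borel (A n)) \<nu>"
    and int: "\<And>n. integrable M (\<lambda>\<omega>. B n \<omega> - A n \<omega>)"
    and L1: "(\<lambda>n. expectation (\<lambda>\<omega>. \<bar>B n \<omega> - A n \<omega>\<bar>)) \<longlonglongrightarrow> 0"
  shows "weak_conv_m (\<lambda>n. distr M borel (B n)) \<nu>"
proof (rule levy_continuity)
  fix t
  have A: "(\<lambda>n. char (distr M borel (A n)) t) \<longlonglongrightarrow> char \<nu> t"
    by (rule levy_continuity1[OF _ \<nu> conv]) auto
  have "(\<lambda>n. char (distr M borel (B n)) t - char (distr M borel (A n)) t) \<longlonglongrightarrow> 0"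
  proof (rule Lim_null_comparison)
    show "(\<lambda>n. \<bar>t\<bar> * expectation (\<lambda>\<omega>. \<bar>B n \<omega> - A n \<omega>\<bar>)) \<longlonglongrightarrow> 0"
      using tendsto_mult_left[OF L1, of "\<bar>t\<bar>"] by simp
    show "\<forall>\<^sub>F n in sequentially. cmod (char (distr M borel (B n)) t - char (distr M borel (A n)) t)
        \<le> \<bar>t\<bar> * expectation (\<lambda>\<omega>. \<bar>B n \<omega> - A n \<omega>\<bar>)"
    proof (intro always_eventually allI)
      fix n
      have int_iexp: "integrable M (\<lambda>\<omega>. iexp (t * Z \<omega>))" if "random_variable borel Z" for Z
        using that by (intro integrable_iexp) auto
      have "char (distr M borel (B n)) t - char (distr M borel (A n)) t
          = (CLINT \<omega>|M. iexp (t * B n \<omega>) - iexp (t * A n \<omega>))"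
        unfolding char_def
        using int_iexp[of "A n"] int_iexp[of "B n"] by (simp add: integral_distr)
      also have "cmod \<dots> \<le> (LINT \<omega>|M. cmod (iexp (t * B n \<omega>) - iexp (t * A n \<omega>)))"
        by (rule integral_norm_bound)
      also have "\<dots> \<le> (LINT \<omega>|M. \<bar>t\<bar> * \<bar>B n \<omega> - A n \<omega>\<bar>)"
      proof (rule integral_mono)
        show "integrable M (\<lambda>\<omega>. cmod (iexp (t * B n \<omega>) - iexp (t * A n \<omega>)))"
          by (intro integrable_norm Bochner_Integration.integrable_diff int_iexp) auto
        show "integrable M (\<lambda>\<omega>. \<bar>t\<bar> * \<bar>B n \<omega> - A n \<omega>\<bar>)" using int by auto
        fix \<omega>
        show "cmod (iexp (t * B n \<omega>) - iexp (t * A n \<omega>)) \<le> \<bar>t\<bar> * \<bar>B n \<omega> - A n \<omega>\<bar>"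
          using norm_iexp_diff_le[of "t * B n \<omega>" "t * A n \<omega>"]
          by (simp add: abs_mult[symmetric] right_diff_distrib)
      qed
      finally show "cmod (char (distr M borel (B n)) t - char (distr M borel (A n)) t)
        \<le> \<bar>t\<bar> * expectation (\<lambda>\<omega>. \<bar>B n \<omega> - A n \<omega>\<bar>)" by simp
    qed
  qed
  from tendsto_add[OF this A] show "(\<lambda>n. char (distr M borel (B n)) t) \<longlonglongrightarrow> char \<nu> t" by simp
qed (auto simp: \<nu>)

text \<open>The degenerate case is included: for \<open>v = 0\<close> every \<open>Z n\<close>
  vanishes almost surely and the sums have characteristic function 1. Otherwise the classical
  theorem applies, and evaluating characteristic functions at \<open>t * sqrt v\<close> undoes its
  standardization.\<close>

lemma (in prob_space) central_limit_normal_law: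
  fixes Z :: "nat \<Rightarrow> 'a \<Rightarrow> real"
  assumes indep: "indep_vars (\<lambda>_. borel) Z UNIV"
    and mean: "\<And>n. expectation (Z n) = 0"
    and sq: "\<And>n. integrable M (\<lambda>\<omega>. (Z n \<omega>)\<^sup>2)"
    and var: "\<And>n. expectation (\<lambda>\<omega>. (Z n \<omega>)\<^sup>2) = v"
    and distrib: "\<And>n. distr M borel (Z n) = \<mu>"
  shows "weak_conv_m (\<lambda>n. distr M borel (\<lambda>\<omega>. (\<Sum>i<n. Z i \<omega>) / sqrt (real n))) (normal_law 0 v)"
proof (rule levy_continuity)
  have [measurable]: "random_variable borel (Z n)" for n
    using indep by (auto simp: indep_vars_def)
  have v: "0 \<le> v" using var[of 0] by (metis Bochner_Integration.integral_nonneg zero_le_power2)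
  show "real_distribution (normal_law 0 v)" by (rule real_distribution_normal_law[OF v])
  show "real_distribution (distr M borel (\<lambda>\<omega>. (\<Sum>i<n. Z i \<omega>) / sqrt (real n)))" for n by auto
  fix t
  show "(\<lambda>n. char (distr M borel (\<lambda>\<omega>. (\<Sum>i<n. Z i \<omega>) / sqrt (real n))) t) \<longlonglongrightarrow> char (normal_law 0 v) t"
  proof (cases "v = 0")
    case True
    have "AE \<omega> in M. Z n \<omega> = 0" for n
      using integral_nonneg_eq_0_iff_AE[OF sq[of n]] var[of n] True by auto
    then have AE: "AE \<omega> in M. \<forall>n. Z n \<omega> = 0" by (simp add: AE_all_countable)
    have "char (distr M borel (\<lambda>\<omega>. (\<Sum>i<n. Z i \<omega>) / sqrt (real n))) t = 1" for n
    proof -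
      have "char (distr M borel (\<lambda>\<omega>. (\<Sum>i<n. Z i \<omega>) / sqrt (real n))) t
          = (CLINT \<omega>|M. iexp (t * ((\<Sum>i<n. Z i \<omega>) / sqrt (real n))))"
        unfolding char_def by (simp add: integral_distr)
      also have "\<dots> = (CLINT \<omega>|M. 1)"
        by (rule integral_cong_AE) (use AE in \<open>auto elim!: eventually_mono\<close>)
      finally show ?thesis by (simp add: prob_space)
    qed
    then show ?thesis using char_normal_law[OF v, of t] True by simp
  next
    case False
    with v have v': "0 < v" by simp
    have "weak_conv_m (\<lambda>n. distr M borel (\<lambda>x. (\<Sum>i<n. Z i x) / sqrt (n * (sqrt v)\<^sup>2))) std_normal_distribution"
      by (rule central_limit_theorem_zero_mean[OF indep mean _ sq _ distrib]) (use v' mean var in auto)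
    then have "(\<lambda>n. char (distr M borel (\<lambda>x. (\<Sum>i<n. Z i x) / sqrt (n * (sqrt v)\<^sup>2))) (t * sqrt v))
        \<longlonglongrightarrow> char std_normal_distribution (t * sqrt v)"
      by (intro levy_continuity1) (auto simp: real_dist_normal_dist)
    moreover have "char (distr M borel (\<lambda>x. (\<Sum>i<n. Z i x) / sqrt (n * (sqrt v)\<^sup>2))) (t * sqrt v)
        = char (distr M borel (\<lambda>\<omega>. (\<Sum>i<n. Z i \<omega>) / sqrt (real n))) t" for n
      unfolding char_def using v' by (simp add: integral_distr real_sqrt_mult)
    moreover have "char std_normal_distribution (t * sqrt v) = char (normal_law 0 v) t"
      using v' by (simp add: char_std_normal_distribution char_normal_law power_mult_distrib mult.commute)
    ultimately show ?thesis by simp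
  qed
qed

section \<open>Second moments of sums\<close>

text \<open>Cauchy-Schwarz against the constant 1 bounds the square of the sum by
  \<open>card I\<close> times the sum of the squares.\<close>

lemma (in prob_space) integrable_power2_sum:
  fixes Z :: "'i \<Rightarrow> 'a \<Rightarrow> real"
  assumes "finite I" "\<And>i. i \<in> I \<Longrightarrow> random_variable borel (Z i)"
    and "\<And>i. i \<in> I \<Longrightarrow> integrable M (\<lambda>\<omega>. (Z i \<omega>)\<^sup>2)"
  shows "integrable M (\<lambda>\<omega>. (\<Sum>i\<in>I. Z i \<omega>)\<^sup>2)"
proof (rule Bochner_Integration.integrable_bound)
  show "integrable M (\<lambda>\<omega>. real (card I) * (\<Sum>i\<in>I. (Z i \<omega>)\<^sup>2))"
    using assms by (intro integrable_mult_right Bochner_Integration.integrable_sum) auto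
  show "(\<lambda>\<omega>. (\<Sum>i\<in>I. Z i \<omega>)\<^sup>2) \<in> borel_measurable M" using assms by measurable
  show "AE \<omega> in M. norm ((\<Sum>i\<in>I. Z i \<omega>)\<^sup>2) \<le> norm (real (card I) * (\<Sum>i\<in>I. (Z i \<omega>)\<^sup>2))"
  proof (rule AE_I2)
    fix \<omega>
    have "(\<Sum>i\<in>I. Z i \<omega>)\<^sup>2 \<le> real (card I) * (\<Sum>i\<in>I. (Z i \<omega>)\<^sup>2)"
      using Cauchy_Schwarz_ineq_sum[of "\<lambda>_. 1" "\<lambda>i. Z i \<omega>" I] by simp
    then show "norm ((\<Sum>i\<in>I. Z i \<omega>)\<^sup>2) \<le> norm (real (card I) * (\<Sum>i\<in>I. (Z i \<omega>)\<^sup>2))"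
      by (simp add: sum_nonneg)
  qed
qed

text \<open>Bienayme's identity: in each induction step the cross term factorizes, as the new
  variable is independent of the partial sum, and vanishes with the means.\<close>

lemma (in prob_space) expectation_power2_sum_indep:
  fixes Z :: "'i \<Rightarrow> 'a \<Rightarrow> real"
  assumes "finite I" "indep_vars (\<lambda>_. borel) Z I"
    and "\<And>i. i \<in> I \<Longrightarrow> integrable M (\<lambda>\<omega>. (Z i \<omega>)\<^sup>2)"
    and "\<And>i. i \<in> I \<Longrightarrow> expectation (Z i) = 0"
  shows "expectation (\<lambda>\<omega>. (\<Sum>i\<in>I. Z i \<omega>)\<^sup>2) = (\<Sum>i\<in>I. expectation (\<lambda>\<omega>. (Z i \<omega>)\<^sup>2))"
  using assms
proof (induction I)
  case empty
  then show ?case by simp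
next
  case (insert i I)
  have rv: "random_variable borel (Z j)" if "j \<in> insert i I" for j
    using insert.prems(1) that by (auto simp: indep_vars_def)
  have int: "integrable M (Z j)" if "j \<in> insert i I" for j
    using square_integrable_imp_integrable[OF rv] insert.prems(2) that by blast
  have indep: "indep_var borel (Z i) borel (\<lambda>\<omega>. \<Sum>j\<in>I. Z j \<omega>)"
    using insert by (intro indep_vars_sum)
  have intS: "integrable M (\<lambda>\<omega>. \<Sum>j\<in>I. Z j \<omega>)"
    using int by (intro Bochner_Integration.integrable_sum) auto
  have intS2: "integrable M (\<lambda>\<omega>. (\<Sum>j\<in>I. Z j \<omega>)\<^sup>2)"
    using insert rv by (intro integrable_power2_sum) auto
  have intP: "integrable M (\<lambda>\<omega>. Z i \<omega> * (\<Sum>j\<in>I. Z j \<omega>))"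
    using int intS by (intro indep_var_integrable[OF indep]) auto
  have "expectation (\<lambda>\<omega>. Z i \<omega> * (\<Sum>j\<in>I. Z j \<omega>)) = 0"
    using indep_var_lebesgue_integral[OF indep] int intS insert.prems(3) by simp
  moreover have "(\<lambda>\<omega>. (\<Sum>j\<in>insert i I. Z j \<omega>)\<^sup>2)
      = (\<lambda>\<omega>. (Z i \<omega>)\<^sup>2 + 2 * (Z i \<omega> * (\<Sum>j\<in>I. Z j \<omega>)) + (\<Sum>j\<in>I. Z j \<omega>)\<^sup>2)"
    using insert by (simp add: power2_sum algebra_simps)
  moreover have "expectation (\<lambda>\<omega>. (\<Sum>j\<in>I. Z j \<omega>)\<^sup>2) = (\<Sum>j\<in>I. expectation (\<lambda>\<omega>. (Z j \<omega>)\<^sup>2))"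
    using insert by (intro insert.IH) (auto intro: indep_vars_subset)
  ultimately show ?case
    using insert intP intS2 by simp
qed

lemma (in prob_space) expectation_abs_le_sqrt:
  fixes Z :: "'a \<Rightarrow> real"
  assumes [measurable]: "random_variable borel Z" and "integrable M (\<lambda>\<omega>. (Z \<omega>)\<^sup>2)"
  shows "expectation (\<lambda>\<omega>. \<bar>Z \<omega>\<bar>) \<le> sqrt (expectation (\<lambda>\<omega>. (Z \<omega>)\<^sup>2))"
proof (rule real_le_rsqrt)
  have "integrable M Z" by (rule square_integrable_imp_integrable) fact+
  then have "variance (\<lambda>\<omega>. \<bar>Z \<omega>\<bar>) = expectation (\<lambda>\<omega>. \<bar>Z \<omega>\<bar>\<^sup>2) - (expectation (\<lambda>\<omega>. \<bar>Z \<omega>\<bar>))\<^sup>2"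
    using assms by (intro variance_eq) auto
  then show "(expectation (\<lambda>\<omega>. \<bar>Z \<omega>\<bar>))\<^sup>2 \<le> expectation (\<lambda>\<omega>. (Z \<omega>)\<^sup>2)"
    using variance_positive[of "\<lambda>\<omega>. \<bar>Z \<omega>\<bar>"] by simp
qed

text \<open>Observations are numbered from 1, the summands of the central limit theorem from 0; this
  transports independence along the shift \<open>Suc\<close>.\<close>

lemma (in prob_space) indep_vars_reindex:
  assumes inj: "inj_on f I" and indep: "indep_vars M' X (f ` I)"
  shows "indep_vars (\<lambda>i. M' (f i)) (\<lambda>i. X (f i)) I"
proof -
  have sets: "indep_sets (\<lambda>i. H (f i)) I" if "indep_sets H (f ` I)" for H
  proof (rule indep_setsI)
    show "H (f i) \<subseteq> events" if "i \<in> I" for i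
      using \<open>indep_sets H (f ` I)\<close> that by (auto simp: indep_sets_def)
    fix A J assume J: "J \<noteq> {}" "J \<subseteq> I" "finite J" and A: "\<forall>j\<in>J. A j \<in> H (f j)"
    define g where "g = the_inv_into I f"
    have g: "g (f j) = j" if "j \<in> J" for j
      using that J inj by (auto simp: g_def the_inv_into_f_f)
    have injJ: "inj_on f J" using inj J by (blast intro: inj_on_subset)
    have "prob (\<Inter>k\<in>f ` J. A (g k)) = (\<Prod>k\<in>f ` J. prob (A (g k)))"
      using J A by (intro indep_setsD[OF that]) (auto simp: g)
    then show "prob (\<Inter>j\<in>J. A j) = (\<Prod>j\<in>J. prob (A j))"
      by (simp add: g prod.reindex[OF injJ] image_image cong: INF_cong)
  qed
  from indep show ?thesis
    unfolding indep_vars_def2 using sets by auto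
qed

section \<open>The uniform law of the level and the indicator functions\<close>

text \<open>The law of the level \<open>s\<close>. As a probability measure on the whole line it
  makes bounded measurable functions of \<open>s\<close> integrable and lets Fubini's theorem act on
  products with \<open>M\<close> and \<open>Q\<close>; the open interval is where derivatives are
  available.\<close>

definition unit_law :: "real measure" where
  "unit_law = density lborel (\<lambda>s. ennreal (indicator {0<..<1} s))"

lemma sets_unit_law [simp, measurable_cong]: "sets unit_law = sets borel"
  and space_unit_law [simp]: "space unit_law = UNIV"
  by (simp_all add: unit_law_def)

lemma integral_unit_law:
  fixes f :: "real \<Rightarrow> real"
  shows "f \<in> borel_measurable borel \<Longrightarrow>
    (LINT s|unit_law. f s) = (LINT s|lborel. indicator {0<..<1} s * f s)"
  unfolding unit_law_def by (subst integral_density) auto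

lemma prob_space_unit_law: "prob_space unit_law"
  by (rule prob_spaceI) (simp add: unit_law_def emeasure_density ennreal_indicator)

lemma AE_unit_law: "AE s in unit_law. 0 < s \<and> s < 1"
  unfolding unit_law_def by (subst AE_density) (auto simp: indicator_def)

text \<open>\<open>a\<close> and \<open>b\<close> may come in either order: an empty interval yields
  the 0 of the positive part. The missing endpoints 0 and 1 are null.\<close>

lemma integral_unit_law_Icc:
  assumes "0 \<le> a" "b \<le> 1"
  shows "(LINT s|unit_law. of_bool (a \<le> s \<and> s \<le> b)) = max (b - a) 0"
proof -
  have "(LINT s|unit_law. of_bool (a \<le> s \<and> s \<le> b) :: real)
      = (LINT s|lborel. indicator {0<..<1} s * of_bool (a \<le> s \<and> s \<le> b))"
    by (rule integral_unit_law) measurable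
  also have "\<dots> = (LINT s|lborel. indicator {a..b} s)"
  proof (rule integral_cong_AE)
    have "AE s in lborel. s \<noteq> 0 \<and> s \<noteq> (1::real)"
      using AE_lborel_singleton[of 0] AE_lborel_singleton[of "1::real"] by eventually_elim auto
    then show "AE s in lborel. indicator {0<..<1} s * of_bool (a \<le> s \<and> s \<le> b)
        = (indicator {a..b} s :: real)"
      by eventually_elim (use assms in \<open>auto simp: indicator_def\<close>)
  qed auto
  also have "\<dots> = max (b - a) 0" by (simp add: max_def)
  finally show ?thesis .
qed

text \<open>The indicators are real-valued functions of level and point, as they serve both as test
  functions of the empirical process and as integrands in the level.\<close>

definition fst_le :: "real \<Rightarrow> real \<times> real \<Rightarrow> real" where
  "fst_le u p = of_bool (fst p \<le> u)"

definition snd_le :: "real \<Rightarrow> real \<times> real \<Rightarrow> real" where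
  "snd_le v p = of_bool (snd p \<le> v)"

definition both_le :: "real \<Rightarrow> real \<Rightarrow> real \<times> real \<Rightarrow> real" where
  "both_le u v p = of_bool (fst p \<le> u \<and> snd p \<le> v)"

lemma fst_le_measurable [measurable]: "fst_le u \<in> borel_measurable borel"
  and snd_le_measurable [measurable]: "snd_le v \<in> borel_measurable borel"
  and both_le_measurable [measurable]: "both_le u v \<in> borel_measurable borel"
  unfolding fst_le_def[abs_def] snd_le_def[abs_def] both_le_def[abs_def] borel_prod[symmetric]
  by measurable

lemma abs_indicators_le: "\<bar>fst_le u p\<bar> \<le> 1" "\<bar>snd_le v p\<bar> \<le> 1" "\<bar>both_le u v p\<bar> \<le> 1"
  by (auto simp: fst_le_def snd_le_def both_le_def)

subsection \<open>The law of the transformed sample\<close>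

locale copula_sample = prob_space M for M :: "'a measure" +
  fixes X Y :: "nat \<Rightarrow> 'a \<Rightarrow> real"
    and D :: "(real \<times> real) measure"
    and C :: "real \<Rightarrow> real \<Rightarrow> real"
  assumes indep: "indep_vars (\<lambda>_. borel) (\<lambda>i \<omega>. (X i \<omega>, Y i \<omega>)) {1..}"
    and ident: "\<And>i. i \<ge> 1 \<Longrightarrow> distr M borel (\<lambda>\<omega>. (X i \<omega>, Y i \<omega>)) = D"
    and copula: "copula C"
    and law: "continuous_law_with_copula D C"
    and partials: "has_continuous_partials C"
begin

definition "F = cdf (distr D borel fst)"
definition "G = cdf (distr D borel snd)"
definition "P i \<omega> = (F (X i \<omega>), G (Y i \<omega>))"
text \<open>\<open>Q\<close> is kept on the Borel sets of the plane and merely concentrated on the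
  unit square, which avoids restricted sigma-algebras; \<open>copula_measure C\<close> is its
  version on the square.\<close>

definition "Q = distr D borel (\<lambda>(x, y). (F x, G y))"

lemma rv_pair: "i \<ge> 1 \<Longrightarrow> random_variable borel (\<lambda>\<omega>. (X i \<omega>, Y i \<omega>))"
  using indep by (auto simp: indep_vars_def)

lemma rv_X [measurable (raw)]: "i \<ge> 1 \<Longrightarrow> random_variable borel (X i)"
  using measurable_compose[OF rv_pair borel_measurable_continuous_onI[OF continuous_on_fst[OF continuous_on_id]]] by simp

lemma rv_Y [measurable (raw)]: "i \<ge> 1 \<Longrightarrow> random_variable borel (Y i)"
  using measurable_compose[OF rv_pair borel_measurable_continuous_onI[OF continuous_on_snd[OF continuous_on_id]]] by simp

lemma sets_D [simp, measurable_cong]: "sets D = sets borel"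
  using ident[of 1, symmetric] by simp

lemma space_D [simp]: "space D = UNIV"
  using sets_eq_imp_space_eq[OF sets_D] by simp

lemma prob_space_D: "prob_space D"
  using prob_space_distr[OF rv_pair[of 1]] ident[of 1] by simp

lemma rv_fst_snd_D [measurable]: "fst \<in> borel_measurable D" "snd \<in> borel_measurable D"
  unfolding measurable_cong_sets[OF sets_D refl] borel_prod[symmetric] by measurable

lemma distr_X: "i \<ge> 1 \<Longrightarrow> distr M borel (X i) = distr D borel fst"
  by (subst ident[of i, symmetric]) (auto simp: distr_distr comp_def rv_pair)

lemma distr_Y: "i \<ge> 1 \<Longrightarrow> distr M borel (Y i) = distr D borel snd"
  by (subst ident[of i, symmetric]) (auto simp: distr_distr comp_def rv_pair)

sublocale D1: real_distribution "distr D borel fst"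
  by (intro prob_space.real_distribution_distr prob_space_D rv_fst_snd_D)

sublocale D2: real_distribution "distr D borel snd"
  by (intro prob_space.real_distribution_distr prob_space_D rv_fst_snd_D)

lemma F_cont: "continuous_on UNIV F" and G_cont: "continuous_on UNIV G"
  and joint_cdf: "measure D ({..x} \<times> {..y}) = C (F x) (G y)"
  using law by (auto simp: continuous_law_with_copula_def F_def G_def Let_def)

lemma F_mono: "x \<le> x' \<Longrightarrow> F x \<le> F x'" and G_mono: "x \<le> x' \<Longrightarrow> G x \<le> G x'"
  unfolding F_def G_def by (auto intro: D1.cdf_nondecreasing D2.cdf_nondecreasing)

lemma F_bounds: "0 \<le> F x" "F x \<le> 1" and G_bounds: "0 \<le> G x" "G x \<le> 1"
  unfolding F_def G_def
  by (auto intro: D1.cdf_nonneg D2.cdf_nonneg D1.cdf_bounded_prob D2.cdf_bounded_prob)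

lemma F_measurable [measurable]: "F \<in> borel_measurable borel"
  and G_measurable [measurable]: "G \<in> borel_measurable borel"
  using F_cont G_cont by (auto intro: borel_measurable_continuous_onI)

lemma rv_P [measurable (raw)]: "i \<ge> 1 \<Longrightarrow> random_variable borel (P i)"
  unfolding P_def[abs_def] borel_prod[symmetric] by measurable

lemma rv_FG: "(\<lambda>(x, y). (F x, G y)) \<in> borel_measurable D"
  unfolding borel_prod[symmetric] by measurable

lemma sets_Q [simp, measurable_cong]: "sets Q = sets borel" and space_Q [simp]: "space Q = UNIV"
  by (simp_all add: Q_def)

sublocale Q: prob_space Q
  unfolding Q_def by (intro prob_space.prob_space_distr prob_space_D rv_FG)

lemma measure_Q_UNIV [simp]: "measure Q UNIV = 1"
  using Q.prob_space by simp

lemma distr_P: "i \<ge> 1 \<Longrightarrow> distr M borel (P i) = Q"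
proof -
  assume i: "i \<ge> 1"
  have "distr (distr M borel (\<lambda>\<omega>. (X i \<omega>, Y i \<omega>))) borel (\<lambda>(x, y). (F x, G y))
      = distr M borel ((\<lambda>(x, y). (F x, G y)) \<circ> (\<lambda>\<omega>. (X i \<omega>, Y i \<omega>)))"
    by (rule distr_distr[OF rv_FG[unfolded measurable_cong_sets[OF sets_D refl]] rv_pair[OF i]])
  then show ?thesis
    by (simp add: ident[OF i] Q_def P_def[abs_def] comp_def)
qed

lemma indep_P: "indep_vars (\<lambda>_. borel) P {1..}"
  unfolding P_def[abs_def]
  using indep_vars_compose2[OF indep, of "\<lambda>_. \<lambda>(x, y). (F x, G y)" "\<lambda>_. borel"]
    rv_FG[unfolded measurable_cong_sets[OF sets_D refl]] by simp

lemma expectation_P: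
  fixes f :: "real \<times> real \<Rightarrow> real"
  assumes "i \<ge> 1" "f \<in> borel_measurable borel"
  shows "expectation (\<lambda>\<omega>. f (P i \<omega>)) = (LINT p|Q. f p)"
  by (subst distr_P[OF assms(1), symmetric], subst integral_distr) (use assms rv_P in auto)

lemma AE_Q_unit_square: "AE p in Q. p \<in> {0..1} \<times> {0..1}"
  unfolding Q_def
proof (subst AE_distr_iff[OF rv_FG])
  show "{x \<in> space borel. x \<in> {0..1} \<times> {0..1}} \<in> sets (borel :: (real \<times> real) measure)"
    by (simp add: borel_closed closed_Times)
qed (auto simp: F_bounds G_bounds)

lemma sets_strip: "{p. fst p \<le> u} \<in> sets (borel :: (real \<times> real) measure)"
  "{p. snd p \<le> u} \<in> sets (borel :: (real \<times> real) measure)"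
  by (auto intro!: closed_Collect_le continuous_intros borel_closed)

lemma measure_Q:
  assumes A: "A \<in> sets borel"
  shows "measure Q A = measure D {(x, y). (F x, G y) \<in> A}"
  unfolding Q_def by (subst measure_distr[OF rv_FG A]) (simp add: vimage_def case_prod_beta')

lemma measure_Q_fst: "0 \<le> u \<Longrightarrow> u \<le> 1 \<Longrightarrow> measure Q {p. fst p \<le> u} = u"
proof -
  assume u: "0 \<le> u" "u \<le> 1"
  have "measure (distr D borel fst) {x. F x \<le> u} = u"
    unfolding F_def by (rule D1.measure_cdf_le[OF F_cont[unfolded F_def] u])
  then show ?thesis
    by (simp add: measure_Q sets_strip measure_distr vimage_def case_prod_beta')
qed

lemma measure_Q_snd: "0 \<le> u \<Longrightarrow> u \<le> 1 \<Longrightarrow> measure Q {p. snd p \<le> u} = u"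
proof -
  assume u: "0 \<le> u" "u \<le> 1"
  have "measure (distr D borel snd) {x. G x \<le> u} = u"
    unfolding G_def by (rule D2.measure_cdf_le[OF G_cont[unfolded G_def] u])
  then show ?thesis
    by (simp add: measure_Q sets_strip measure_distr vimage_def case_prod_beta')
qed

text \<open>The vanishing edges follow from the margins: monotonicity puts \<open>C u 0\<close>
  between 0 and \<open>C 1 0\<close>, which the uniform margin makes 0.\<close>

lemma copula_edges:
  assumes "0 \<le> u" "u \<le> 1"
  shows "C u 1 = u" "C 1 u = u" "C u 0 = 0" "C 0 u = 0"
proof -
  obtain \<mu> where \<mu>: "copula_law C \<mu>" and C1: "\<And>v. 0 \<le> v \<Longrightarrow> v \<le> 1 \<Longrightarrow> C v 1 = v \<and> C 1 v = v"
    using copula by (auto simp: copula_def)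
  interpret \<mu>: prob_space \<mu> using \<mu> by (simp add: copula_law_def)
  have sets: "sets \<mu> = sets (restrict_space borel ({0..1} \<times> {0..1}))"
    and C: "\<And>u v. 0 \<le> u \<Longrightarrow> u \<le> 1 \<Longrightarrow> 0 \<le> v \<Longrightarrow> v \<le> 1 \<Longrightarrow> C u v = measure \<mu> ({0..u} \<times> {0..v})"
    using \<mu> by (auto simp: copula_law_def)
  have in_sets: "{0..u} \<times> {0..v} \<in> sets \<mu>" if "u \<le> 1" "v \<le> 1" for u v :: real
    unfolding sets using that
    by (subst sets_restrict_space_iff) (auto intro!: borel_closed closed_Times)
  have mono: "C u v \<le> C u' v'" if "0 \<le> u" "u \<le> u'" "u' \<le> 1" "0 \<le> v" "v \<le> v'" "v' \<le> 1" for u v u' v'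
    using that by (simp add: C) (intro \<mu>.finite_measure_mono in_sets, auto)
  have nonneg: "0 \<le> C u v" if "0 \<le> u" "u \<le> 1" "0 \<le> v" "v \<le> 1" for u v
    using that by (simp add: C)
  show "C u 1 = u" "C 1 u = u" using C1 assms by auto
  show "C u 0 = 0" using mono[of u 1 0 0] nonneg[of u 0] C1[of 0] assms by simp
  show "C 0 u = 0" using mono[of 0 0 u 1] nonneg[of 0 u] C1[of 0] assms by simp
qed

text \<open>In the interior both level sets are half-lines ending at points of exact level, so
  \<open>joint_cdf\<close> applies. On the boundary this can fail and the margins decide: a side 0
  gives a null set, and a side 1 imposes no condition because \<open>Q\<close> lives on the unit
  square.\<close>

lemma measure_Q_rect:
  assumes u: "0 \<le> u" "u \<le> 1" and v: "0 \<le> v" "v \<le> 1"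
  shows "measure Q {p. fst p \<le> u \<and> snd p \<le> v} = C u v"
proof -
  let ?R = "{p. fst p \<le> u \<and> snd p \<le> v}"
  have R: "?R \<in> sets borel"
    using sets.Int[OF sets_strip(1)[of u] sets_strip(2)[of v]] by (simp add: Collect_conj_eq)
  have R1: "measure Q ?R \<le> measure Q {p. fst p \<le> u}" and R2: "measure Q ?R \<le> measure Q {p. snd p \<le> v}"
    by (intro Q.finite_measure_mono; auto simp: sets_strip)+
  consider "u = 0" | "v = 0" | "u = 1" | "v = 1" | "0 < u" "u < 1" "0 < v" "v < 1"
    using u v by linarith
  then show ?thesis
  proof cases
    case 1
    then show ?thesis using R1 measure_Q_fst[OF u] copula_edges[OF v] by (simp add: measure_le_0_iff)
  next
    case 2
    then show ?thesis using R2 measure_Q_snd[OF v] copula_edges[OF u] by (simp add: measure_le_0_iff)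
  next
    case 3
    have "measure Q ?R = measure Q {p. snd p \<le> v}"
      using AE_Q_unit_square 3
      by (intro measure_eq_AE) (auto simp: R sets_strip elim!: eventually_mono)
    then show ?thesis using 3 measure_Q_snd[OF v] copula_edges[OF v] by simp
  next
    case 4
    have "measure Q ?R = measure Q {p. fst p \<le> u}"
      using AE_Q_unit_square 4
      by (intro measure_eq_AE) (auto simp: R sets_strip elim!: eventually_mono)
    then show ?thesis using 4 measure_Q_fst[OF u] copula_edges[OF u] by simp
  next
    case 5
    obtain a where a: "F a = u" "{x. F x \<le> u} = {..a}"
      using D1.continuous_cdf_level[OF F_cont[unfolded F_def], of u] 5 by (auto simp: F_def)
    obtain b where b: "G b = v" "{x. G x \<le> v} = {..b}"
      using D2.continuous_cdf_level[OF G_cont[unfolded G_def], of v] 5 by (auto simp: G_def)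
    have "measure Q ?R = measure D ({x. F x \<le> u} \<times> {y. G y \<le> v})"
      unfolding measure_Q[OF R] by (rule arg_cong[where f="measure D"]) auto
    also have "\<dots> = C u v" unfolding a(2) b(2) joint_cdf a(1) b(1) ..
    finally show ?thesis .
  qed
qed

text \<open>Evaluates the definite description in \<open>copula_measure\<close>: the image of
  \<open>D\<close> satisfies \<open>copula_law C\<close>, and such a law is unique.\<close>

lemma copula_measure_eq:
  "copula_measure C = distr D (restrict_space borel ({0..1} \<times> {0..1})) (\<lambda>(x, y). (F x, G y))"
  (is "_ = ?\<nu>")
proof -
  have meas: "(\<lambda>(x, y). (F x, G y)) \<in> measurable D (restrict_space borel ({0..1} \<times> {0..1}))"
    by (rule measurable_restrict_space2) (auto simp: F_bounds G_bounds rv_FG)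
  have "copula_law C ?\<nu>"
    unfolding copula_law_def
  proof (intro conjI ballI)
    show "prob_space ?\<nu>" by (intro prob_space.prob_space_distr prob_space_D meas)
    show "sets ?\<nu> = sets (restrict_space borel ({0..1} \<times> {0..1}))" by simp
    fix u v :: real assume uv: "u \<in> {0..1}" "v \<in> {0..1}"
    have "{0..u} \<times> {0..v} \<in> sets (restrict_space borel ({0..1} \<times> {0..1}))"
      using uv by (subst sets_restrict_space_iff) (auto intro!: borel_closed closed_Times)
    then have "measure ?\<nu> ({0..u} \<times> {0..v}) = measure D {(x, y). F x \<le> u \<and> G y \<le> v}"
      by (subst measure_distr[OF meas]) (auto intro!: arg_cong[where f="measure D"] simp: F_bounds G_bounds)
    also have "\<dots> = measure Q {p. fst p \<le> u \<and> snd p \<le> v}"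
    proof -
      have "{p. fst p \<le> u \<and> snd p \<le> v} \<in> sets (borel :: (real \<times> real) measure)"
        using sets.Int[OF sets_strip(1)[of u] sets_strip(2)[of v]] by (simp add: Collect_conj_eq)
      from measure_Q[OF this] show ?thesis by simp
    qed
    also have "\<dots> = C u v" using uv by (intro measure_Q_rect) auto
    finally show "C u v = measure ?\<nu> ({0..u} \<times> {0..v})" by simp
  qed
  then show ?thesis
    using copula_law_copula_measure[OF copula] copula_law_unique by blast
qed

text \<open>Agreement on the square and measurability of \<open>g\<close> are what is asked, so that
  \<open>f\<close> may be \<open>j_fun\<close>, which is uncontrolled outside the square.\<close>

lemma integral_copula_measure:
  fixes f g :: "real \<times> real \<Rightarrow> real"
  assumes g: "g \<in> borel_measurable borel"
    and eq: "\<And>p. p \<in> {0..1} \<times> {0..1} \<Longrightarrow> f p = g p"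
  shows "(LINT p|copula_measure C. f p) = (LINT p|Q. g p)"
proof -
  have meas: "(\<lambda>(x, y). (F x, G y)) \<in> measurable D (restrict_space borel ({0..1} \<times> {0..1}))"
    by (rule measurable_restrict_space2) (auto simp: F_bounds G_bounds rv_FG)
  have "(LINT p|copula_measure C. f p) = (LINT p|copula_measure C. g p)"
    using eq by (intro Bochner_Integration.integral_cong) (auto simp: copula_measure_eq space_restrict_space)
  also have "\<dots> = (LINT d|D. g (case d of (x, y) \<Rightarrow> (F x, G y)))"
    unfolding copula_measure_eq by (rule integral_distr[OF meas]) (intro measurable_restrict_space1 g)
  also have "\<dots> = (LINT p|Q. g p)"
    unfolding Q_def by (rule integral_distr[OF rv_FG g, symmetric])
  finally show ?thesis .
qed

text \<open>Continuous margins have no atoms, so under the product law of two observations the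
  diagonal has null sections.\<close>

lemma AE_no_ties: "AE \<omega> in M. \<forall>n. inj_on (\<lambda>i. X i \<omega>) {1..n} \<and> inj_on (\<lambda>i. Y i \<omega>) {1..n}"
proof -
  have distinct: "AE \<omega> in M. Z i \<omega> \<noteq> Z j \<omega>"
    if ij: "i \<noteq> j" and ind: "indep_vars (\<lambda>_. borel) Z {i, j}"
      and dist: "distr M borel (Z j) = N" "real_distribution N" "continuous_on UNIV (cdf N)"
    for Z :: "nat \<Rightarrow> 'a \<Rightarrow> real" and i j N
  proof -
    interpret N: real_distribution N by fact
    have [measurable]: "random_variable borel (Z i)" "random_variable borel (Z j)"
      using ind by (auto simp: indep_vars_def)
    \<comment> \<open>The sum over a singleton turns independence of the family into independence of
      the pair.\<close>
    have "indep_var borel (Z i) borel (\<lambda>\<omega>. \<Sum>j\<in>{j}. Z j \<omega>)"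
      using ij ind by (intro indep_vars_sum) auto
    then have eq: "distr M borel (Z i) \<Otimes>\<^sub>M N = distr M (borel \<Otimes>\<^sub>M borel) (\<lambda>\<omega>. (Z i \<omega>, Z j \<omega>))"
      by (simp add: indep_var_distribution_eq dist)
    have null: "emeasure N {x} = 0" for x
    proof -
      have "isCont (cdf N) x" using dist(3) by (simp add: continuous_on_eq_continuous_at)
      then show ?thesis by (simp add: N.isCont_cdf N.emeasure_eq_measure)
    qed
    have diag: "{p. fst p = snd p} \<in> sets (borel \<Otimes>\<^sub>M borel :: (real \<times> real) measure)"
      unfolding borel_prod by (intro borel_closed closed_Collect_eq continuous_intros)
    have "emeasure M {\<omega> \<in> space M. Z i \<omega> = Z j \<omega>}
        = emeasure (distr M (borel \<Otimes>\<^sub>M borel) (\<lambda>\<omega>. (Z i \<omega>, Z j \<omega>))) {p. fst p = snd p}"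
      by (subst emeasure_distr[OF _ diag]) (auto intro!: arg_cong[where f="emeasure M"])
    also have "\<dots> = (\<integral>\<^sup>+x. emeasure N (Pair x -` {p. fst p = snd p}) \<partial>distr M borel (Z i))"
      unfolding eq[symmetric] by (rule N.emeasure_pair_measure_alt)
        (use diag in \<open>simp add: sets_pair_measure_cong[of _ borel N borel]\<close>)
    also have "\<dots> = 0"
      by (simp add: vimage_def null)
    finally show ?thesis by (intro AE_I[of _ _ "{\<omega> \<in> space M. Z i \<omega> = Z j \<omega>}"]) auto
  qed
  have "AE \<omega> in M. X i \<omega> \<noteq> X j \<omega> \<and> Y i \<omega> \<noteq> Y j \<omega>" if "i \<ge> 1" "j \<ge> 1" "i \<noteq> j" for i j
  proof -
    have ind: "indep_vars (\<lambda>_. borel) (\<lambda>i \<omega>. (X i \<omega>, Y i \<omega>)) {i, j}"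
      using that by (intro indep_vars_subset[OF indep]) auto
    have "AE \<omega> in M. X i \<omega> \<noteq> X j \<omega>"
      using indep_vars_compose2[OF ind, of "\<lambda>_. fst" "\<lambda>_. borel"] that
      by (intro distinct[OF _ _ distr_X]) (auto simp: D1.real_distribution_axioms F_cont[unfolded F_def])
    moreover have "AE \<omega> in M. Y i \<omega> \<noteq> Y j \<omega>"
      using indep_vars_compose2[OF ind, of "\<lambda>_. snd" "\<lambda>_. borel"] that
      by (intro distinct[OF _ _ distr_Y]) (auto simp: D2.real_distribution_axioms G_cont[unfolded G_def])
    ultimately show ?thesis by eventually_elim simp
  qed
  then have "AE \<omega> in M. \<forall>i j. i \<ge> 1 \<longrightarrow> j \<ge> 1 \<longrightarrow> i \<noteq> j \<longrightarrow> X i \<omega> \<noteq> X j \<omega> \<and> Y i \<omega> \<noteq> Y j \<omega>"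
    by (simp add: AE_all_countable)
  then show ?thesis
    by eventually_elim (meson atLeastAtMost_iff inj_onI)
qed

subsection \<open>The empirical process at fixed sets\<close>

text \<open>For \<open>n = 0\<close> the quotient is 0, so the moment bounds below hold for every
  \<open>n\<close>.\<close>

definition emp_process :: "(real \<times> real \<Rightarrow> real) \<Rightarrow> nat \<Rightarrow> 'a \<Rightarrow> real" where
  "emp_process g n \<omega> = (\<Sum>i=1..n. g (P i \<omega>) - (LINT p|Q. g p)) / sqrt (real n)"

lemma integrable_Q:
  fixes g :: "real \<times> real \<Rightarrow> real"
  assumes "g \<in> borel_measurable borel" "\<And>p. \<bar>g p\<bar> \<le> B"
  shows "integrable Q g"
  using assms by (intro Q.integrable_const_bound[where B=B]) (auto simp: measurable_cong_sets[OF sets_Q refl])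

lemma rv_emp_process:
  assumes "g \<in> borel_measurable borel"
  shows "random_variable borel (emp_process g n)"
  unfolding emp_process_def[abs_def]
  by (intro borel_measurable_divide borel_measurable_sum borel_measurable_diff
      measurable_compose[OF rv_P assms]) auto

text \<open>By independence the second moment is the variance of \<open>g\<close> under
  \<open>Q\<close> for \<open>n > 0\<close>, and it is 0 for \<open>n = 0\<close>; dropping the
  squared mean covers both.\<close>

lemma emp_process_second_moment:
  fixes g :: "real \<times> real \<Rightarrow> real"
  assumes g [measurable]: "g \<in> borel_measurable borel" and B: "\<And>p. \<bar>g p\<bar> \<le> B"
  shows "integrable M (\<lambda>\<omega>. (emp_process g n \<omega>)\<^sup>2)"
    and "expectation (\<lambda>\<omega>. (emp_process g n \<omega>)\<^sup>2) \<le> (LINT p|Q. (g p)\<^sup>2)"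
proof -
  define m where "m = (LINT p|Q. g p)"
  define Z where "Z i \<omega> = g (P i \<omega>) - m" for i \<omega>
  have int: "integrable Q g" by (rule integrable_Q[OF g B])
  have g2: "(g p)\<^sup>2 \<le> B\<^sup>2" for p
    using power_mono[OF B[of p], of 2] by simp
  have int2: "integrable Q (\<lambda>p. (g p)\<^sup>2)"
    using g2 by (intro integrable_Q[where B="B\<^sup>2"]) auto
  have rv: "random_variable borel (Z i)" if "i \<in> {1..n}" for i
    unfolding Z_def using that by (intro borel_measurable_diff measurable_compose[OF rv_P g]) auto
  have indep: "indep_vars (\<lambda>_. borel) Z {1..n}"
    unfolding Z_def
    by (rule indep_vars_compose2[where Y="\<lambda>_ p. g p - m"], rule indep_vars_subset[OF indep_P]) auto
  have mean: "expectation (Z i) = 0" if "i \<in> {1..n}" for i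
  proof -
    have "expectation (\<lambda>\<omega>. g (P i \<omega>) - m) = (LINT p|Q. g p - m)"
      using that by (intro expectation_P) auto
    then show ?thesis using int by (simp add: Z_def[abs_def] Q.prob_space m_def)
  qed
  have var: "expectation (\<lambda>\<omega>. (Z i \<omega>)\<^sup>2) = (LINT p|Q. (g p)\<^sup>2) - m\<^sup>2" if "i \<in> {1..n}" for i
  proof -
    have "expectation (\<lambda>\<omega>. (g (P i \<omega>) - m)\<^sup>2) = (LINT p|Q. (g p - m)\<^sup>2)"
      using that by (intro expectation_P) auto
    also have "\<dots> = (LINT p|Q. (g p)\<^sup>2) - m\<^sup>2"
      unfolding m_def by (rule Q.variance_eq[OF int int2])
    finally show ?thesis by (simp add: Z_def[abs_def])
  qed
  have sq: "integrable M (\<lambda>\<omega>. (Z i \<omega>)\<^sup>2)" if "i \<in> {1..n}" for i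
  proof (rule integrable_const_bound[where B="(B + \<bar>m\<bar>)\<^sup>2"])
    show "AE \<omega> in M. norm ((Z i \<omega>)\<^sup>2) \<le> (B + \<bar>m\<bar>)\<^sup>2"
    proof (rule AE_I2)
      fix \<omega>
      have "\<bar>Z i \<omega>\<bar> \<le> B + \<bar>m\<bar>" using B[of "P i \<omega>"] by (simp add: Z_def abs_le_iff) linarith
      from power_mono[OF this, of 2] show "norm ((Z i \<omega>)\<^sup>2) \<le> (B + \<bar>m\<bar>)\<^sup>2" by simp
    qed
  qed (use rv that in measurable)
  have emp_process: "(emp_process g n \<omega>)\<^sup>2 = (\<Sum>i=1..n. Z i \<omega>)\<^sup>2 / real n" for \<omega>
    by (simp add: emp_process_def Z_def m_def power_divide)
  show "integrable M (\<lambda>\<omega>. (emp_process g n \<omega>)\<^sup>2)"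
    unfolding emp_process using rv sq by (intro integrable_divide integrable_power2_sum) auto
  have "expectation (\<lambda>\<omega>. (emp_process g n \<omega>)\<^sup>2) = (\<Sum>i=1..n. (LINT p|Q. (g p)\<^sup>2) - m\<^sup>2) / real n"
    unfolding emp_process using expectation_power2_sum_indep[OF _ indep sq mean] var by simp
  also have "\<dots> \<le> (LINT p|Q. (g p)\<^sup>2)"
    by (cases "n = 0") auto
  finally show "expectation (\<lambda>\<omega>. (emp_process g n \<omega>)\<^sup>2) \<le> (LINT p|Q. (g p)\<^sup>2)" .
qed

lemma emp_process_diff:
  assumes "integrable Q g" "integrable Q h"
  shows "emp_process (\<lambda>p. g p - h p) n \<omega> = emp_process g n \<omega> - emp_process h n \<omega>"
proof -
  have "(\<Sum>i=1..n. g (P i \<omega>) - h (P i \<omega>) - (LINT p|Q. g p - h p))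
      = (\<Sum>i=1..n. g (P i \<omega>) - (LINT p|Q. g p)) - (\<Sum>i=1..n. h (P i \<omega>) - (LINT p|Q. h p))"
    using assms by (subst sum_subtractf[symmetric], intro sum.cong) auto
  then show ?thesis by (simp add: emp_process_def diff_divide_distrib)
qed

lemma expectation_abs_emp_process_le:
  fixes g :: "real \<times> real \<Rightarrow> real"
  assumes g: "g \<in> borel_measurable borel" "\<And>p. \<bar>g p\<bar> \<le> B"
  shows "integrable M (emp_process g n)" 
    and "expectation (\<lambda>\<omega>. \<bar>emp_process g n \<omega>\<bar>) \<le> sqrt (LINT p|Q. (g p)\<^sup>2)"
proof -
  show "integrable M (emp_process g n)"
    by (rule square_integrable_imp_integrable[OF rv_emp_process[OF g(1)] emp_process_second_moment(1)[OF g]])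
  have "expectation (\<lambda>\<omega>. \<bar>emp_process g n \<omega>\<bar>) \<le> sqrt (expectation (\<lambda>\<omega>. (emp_process g n \<omega>)\<^sup>2))"
    by (rule expectation_abs_le_sqrt[OF rv_emp_process[OF g(1)] emp_process_second_moment(1)[OF g]])
  also have "\<dots> \<le> sqrt (LINT p|Q. (g p)\<^sup>2)"
    by (intro real_sqrt_le_mono emp_process_second_moment(2)[OF g])
  finally show "expectation (\<lambda>\<omega>. \<bar>emp_process g n \<omega>\<bar>) \<le> sqrt (LINT p|Q. (g p)\<^sup>2)" .
qed

lemma integrable_indicators [simp]:
  "integrable Q (fst_le u)" "integrable Q (snd_le v)" "integrable Q (both_le u v)"
  by (rule integrable_Q[where B=1]; simp add: abs_indicators_le)+

lemma integral_fst_le: "0 \<le> u \<Longrightarrow> u \<le> 1 \<Longrightarrow> (LINT p|Q. fst_le u p) = u"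
  and integral_snd_le: "0 \<le> v \<Longrightarrow> v \<le> 1 \<Longrightarrow> (LINT p|Q. snd_le v p) = v"
  and integral_both_le:
    "0 \<le> u \<Longrightarrow> u \<le> 1 \<Longrightarrow> 0 \<le> v \<Longrightarrow> v \<le> 1 \<Longrightarrow> (LINT p|Q. both_le u v p) = C u v"
proof -
  have ind: "fst_le u = indicator {p. fst p \<le> u}" "snd_le v = indicator {p. snd p \<le> v}"
    "both_le u v = indicator {p. fst p \<le> u \<and> snd p \<le> v}"
    by (auto simp: fst_le_def snd_le_def both_le_def indicator_def)
  show "0 \<le> u \<Longrightarrow> u \<le> 1 \<Longrightarrow> (LINT p|Q. fst_le u p) = u"
    "0 \<le> v \<Longrightarrow> v \<le> 1 \<Longrightarrow> (LINT p|Q. snd_le v p) = v"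
    "0 \<le> u \<Longrightarrow> u \<le> 1 \<Longrightarrow> 0 \<le> v \<Longrightarrow> v \<le> 1 \<Longrightarrow> (LINT p|Q. both_le u v p) = C u v"
    unfolding ind by (simp_all add: measure_Q_fst measure_Q_snd measure_Q_rect)
qed

lemmas integral_indicators = integral_fst_le integral_snd_le integral_both_le

text \<open>The squares are indicators of symmetric differences: strips for nested half-planes, and
  for two rectangles a set covered by the two strips between their sides.\<close>

lemma integral_increment_squares:
  assumes "u \<in> {0..1}" "s \<in> {0..1}" "v \<in> {0..1}" "t \<in> {0..1}"
  shows "(LINT p|Q. (fst_le u p - fst_le s p)\<^sup>2) = \<bar>u - s\<bar>"
    and "(LINT p|Q. (snd_le v p - snd_le t p)\<^sup>2) = \<bar>v - t\<bar>"
    and "(LINT p|Q. (both_le u v p - both_le s t p)\<^sup>2) \<le> \<bar>u - s\<bar> + \<bar>v - t\<bar>"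
proof -
  have 1: "(\<lambda>p. (fst_le u p - fst_le s p)\<^sup>2) = (\<lambda>p. fst_le (max u s) p - fst_le (min u s) p)"
    by (auto simp: fst_le_def max_def min_def)
  have 2: "(\<lambda>p. (snd_le v p - snd_le t p)\<^sup>2) = (\<lambda>p. snd_le (max v t) p - snd_le (min v t) p)"
    by (auto simp: snd_le_def max_def min_def)
  show eq1: "(LINT p|Q. (fst_le u p - fst_le s p)\<^sup>2) = \<bar>u - s\<bar>"
    unfolding 1 using assms by (auto simp: integral_indicators max_def min_def)
  show eq2: "(LINT p|Q. (snd_le v p - snd_le t p)\<^sup>2) = \<bar>v - t\<bar>"
    unfolding 2 using assms by (auto simp: integral_indicators max_def min_def)
  have int1: "integrable Q (\<lambda>p. (fst_le u p - fst_le s p)\<^sup>2)" unfolding 1 by simp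
  have int2: "integrable Q (\<lambda>p. (snd_le v p - snd_le t p)\<^sup>2)" unfolding 2 by simp
  have "(LINT p|Q. (both_le u v p - both_le s t p)\<^sup>2)
      \<le> (LINT p|Q. (fst_le u p - fst_le s p)\<^sup>2 + (snd_le v p - snd_le t p)\<^sup>2)"
  proof (rule integral_mono)
    show "integrable Q (\<lambda>p. (both_le u v p - both_le s t p)\<^sup>2)"
      by (rule integrable_Q[where B=1]) (auto simp: both_le_def)
    show "integrable Q (\<lambda>p. (fst_le u p - fst_le s p)\<^sup>2 + (snd_le v p - snd_le t p)\<^sup>2)"
      using int1 int2 by simp
    show "(both_le u v p - both_le s t p)\<^sup>2
        \<le> (fst_le u p - fst_le s p)\<^sup>2 + (snd_le v p - snd_le t p)\<^sup>2" for p
      by (auto simp: both_le_def fst_le_def snd_le_def)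
  qed
  also have "\<dots> = \<bar>u - s\<bar> + \<bar>v - t\<bar>" using int1 int2 eq1 eq2 by simp
  finally show "(LINT p|Q. (both_le u v p - both_le s t p)\<^sup>2) \<le> \<bar>u - s\<bar> + \<bar>v - t\<bar>" .
qed

text \<open>\<open>emp_process\<close> is linear in the test function, so the moment bound applies
  to differences of indicators. For thresholds at distance of order \<open>1 / sqrt n\<close> the
  bounds are of order \<open>n\<close> to the power \<open>-1/4\<close>.\<close>

lemma expectation_abs_emp_process_increments:
  assumes uv: "u \<in> {0..1}" "s \<in> {0..1}" "v \<in> {0..1}" "t \<in> {0..1}"
  shows "expectation (\<lambda>\<omega>. \<bar>emp_process (fst_le u) n \<omega> - emp_process (fst_le s) n \<omega>\<bar>) \<le> sqrt \<bar>u - s\<bar>"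
    and "expectation (\<lambda>\<omega>. \<bar>emp_process (snd_le v) n \<omega> - emp_process (snd_le t) n \<omega>\<bar>) \<le> sqrt \<bar>v - t\<bar>"
    and "expectation (\<lambda>\<omega>. \<bar>emp_process (both_le u v) n \<omega> - emp_process (both_le s t) n \<omega>\<bar>)
      \<le> sqrt (\<bar>u - s\<bar> + \<bar>v - t\<bar>)"
proof -
  have *: "expectation (\<lambda>\<omega>. \<bar>emp_process g n \<omega> - emp_process h n \<omega>\<bar>) \<le> sqrt (LINT p|Q. (g p - h p)\<^sup>2)"
    if "g \<in> borel_measurable borel" "h \<in> borel_measurable borel"
      "\<And>p. \<bar>g p\<bar> \<le> 1" "\<And>p. \<bar>h p\<bar> \<le> 1" for g h
  proof -
    have "\<bar>g p - h p\<bar> \<le> 2" for p using that(3)[of p] that(4)[of p] by linarith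
    then have "expectation (\<lambda>\<omega>. \<bar>emp_process (\<lambda>p. g p - h p) n \<omega>\<bar>) \<le> sqrt (LINT p|Q. (g p - h p)\<^sup>2)"
      using that by (intro expectation_abs_emp_process_le) auto
    moreover have "integrable Q g" "integrable Q h" using that integrable_Q[where B=1] by blast+
    ultimately show ?thesis by (simp add: emp_process_diff)
  qed
  show "expectation (\<lambda>\<omega>. \<bar>emp_process (fst_le u) n \<omega> - emp_process (fst_le s) n \<omega>\<bar>) \<le> sqrt \<bar>u - s\<bar>"
    using *[of "fst_le u" "fst_le s"] integral_increment_squares(1)[OF uv]
    by (simp add: abs_indicators_le)
  show "expectation (\<lambda>\<omega>. \<bar>emp_process (snd_le v) n \<omega> - emp_process (snd_le t) n \<omega>\<bar>) \<le> sqrt \<bar>v - t\<bar>"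
    using *[of "snd_le v" "snd_le t"] integral_increment_squares(2)[OF uv]
    by (simp add: abs_indicators_le)
  show "expectation (\<lambda>\<omega>. \<bar>emp_process (both_le u v) n \<omega> - emp_process (both_le s t) n \<omega>\<bar>)
      \<le> sqrt (\<bar>u - s\<bar> + \<bar>v - t\<bar>)"
    using *[of "both_le u v" "both_le s t"] integral_increment_squares(3)[OF uv]
    by (simp add: abs_indicators_le) (meson order_trans real_sqrt_le_mono)
qed

lemma expectation_emp_process_indicator_square:
  "expectation (\<lambda>\<omega>. (emp_process (fst_le u) n \<omega>)\<^sup>2) \<le> 1"
  "expectation (\<lambda>\<omega>. (emp_process (snd_le v) n \<omega>)\<^sup>2) \<le> 1"
proof -
  have "(LINT p|Q. (fst_le u p)\<^sup>2) \<le> (LINT p|Q. 1)" "(LINT p|Q. (snd_le v p)\<^sup>2) \<le> (LINT p|Q. 1)"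
    by (intro integral_mono integrable_Q[where B=1]; auto simp: fst_le_def snd_le_def)+
  then show "expectation (\<lambda>\<omega>. (emp_process (fst_le u) n \<omega>)\<^sup>2) \<le> 1"
    "expectation (\<lambda>\<omega>. (emp_process (snd_le v) n \<omega>)\<^sup>2) \<le> 1"
    using emp_process_second_moment(2)[OF fst_le_measurable abs_indicators_le(1), of u n]
      emp_process_second_moment(2)[OF snd_le_measurable abs_indicators_le(2), of v n]
    by simp_all
qed

section \<open>Partial derivatives along the anti-diagonal\<close>

text \<open>Set to 0 off the open interval, where differentiability is not assumed; measurability
  and the bounds 0 and 1 then hold on the whole line.\<close>

definition diag_partial1 :: "real \<Rightarrow> real" where
  "diag_partial1 s = indicator {0<..<1} s * partial1 C s (1 - s)"

definition diag_partial2 :: "real \<Rightarrow> real" where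
  "diag_partial2 s = indicator {0<..<1} s * partial2 C s (1 - s)"

text \<open>All bounds integrate pointwise inequalities between indicators: a difference of nested
  rectangles is nonnegative and lies in a strip of mass \<open>u' - u\<close>.\<close>

lemma copula_increment:
  assumes "0 \<le> u" "u \<le> u'" "u' \<le> 1" "0 \<le> v" "v \<le> 1"
  shows "0 \<le> C u' v - C u v" "C u' v - C u v \<le> u' - u" "0 \<le> C v u' - C v u" "C v u' - C v u \<le> u' - u"
proof -
  have "(LINT p|Q. both_le u v p) \<le> (LINT p|Q. both_le u' v p)"
    "(LINT p|Q. both_le v u p) \<le> (LINT p|Q. both_le v u' p)"
    using assms by (intro integral_mono integrable_indicators; auto simp: both_le_def)+
  then show "0 \<le> C u' v - C u v" "0 \<le> C v u' - C v u"
    using assms by (simp_all add: integral_indicators)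
  have "(LINT p|Q. both_le u' v p - both_le u v p) \<le> (LINT p|Q. fst_le u' p - fst_le u p)"
    "(LINT p|Q. both_le v u' p - both_le v u p) \<le> (LINT p|Q. snd_le u' p - snd_le u p)"
    using assms
    by (intro integral_mono Bochner_Integration.integrable_diff integrable_indicators;
        auto simp: both_le_def fst_le_def snd_le_def)+
  then show "C u' v - C u v \<le> u' - u" "C v u' - C v u \<le> u' - u"
    using assms by (simp_all add: integral_indicators)
qed

lemma partial_derivatives:
  assumes "0 < u" "u < 1" "0 < v" "v < 1"
  shows "((\<lambda>s. C s v) has_field_derivative partial1 C u v) (at u)"
    and "((\<lambda>t. C u t) has_field_derivative partial2 C u v) (at v)"
  using partials assms
  by (auto simp: has_continuous_partials_def partial1_def partial2_def DERIV_deriv_iff_real_differentiable)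

lemma derivative_unit_interval:
  fixes f :: "real \<Rightarrow> real"
  assumes deriv: "(f has_field_derivative d) (at u)" and u: "0 < u" "u < 1"
    and incr: "\<And>a b. 0 \<le> a \<Longrightarrow> a \<le> b \<Longrightarrow> b \<le> 1 \<Longrightarrow> 0 \<le> f b - f a \<and> f b - f a \<le> b - a"
  shows "0 \<le> d \<and> d \<le> 1"
proof -
  have lim: "((\<lambda>h. (f (u + h) - f u) / h) \<longlongrightarrow> d) (at_right 0)"
    using deriv unfolding DERIV_def by (rule tendsto_mono[rotated]) (simp add: at_le)
  have ev: "\<forall>\<^sub>F h in at_right 0. 0 \<le> (f (u + h) - f u) / h \<and> (f (u + h) - f u) / h \<le> 1"
    unfolding eventually_at_right_field
  proof (intro exI[of _ "1 - u"] conjI allI impI)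
    fix h assume h: "0 < h" "h < 1 - u"
    have "0 \<le> f (u + h) - f u" "f (u + h) - f u \<le> h" using incr[of u "u + h"] u h by auto
    then show "0 \<le> (f (u + h) - f u) / h" "(f (u + h) - f u) / h \<le> 1" using h by auto
  qed (use u in simp)
  show ?thesis
    using tendsto_lowerbound[OF lim] tendsto_upperbound[OF lim] ev[unfolded eventually_conj_iff]
    by simp
qed

lemma diag_partial_bounds: "0 \<le> diag_partial1 s" "diag_partial1 s \<le> 1" "0 \<le> diag_partial2 s" "diag_partial2 s \<le> 1"
proof -
  have "0 \<le> partial1 C s (1 - s) \<and> partial1 C s (1 - s) \<le> 1"
    and "0 \<le> partial2 C s (1 - s) \<and> partial2 C s (1 - s) \<le> 1" if s: "0 < s" "s < 1"
  proof -
    show "0 \<le> partial1 C s (1 - s) \<and> partial1 C s (1 - s) \<le> 1"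
      by (rule derivative_unit_interval[OF partial_derivatives(1)])
        (use s copula_increment(1,2)[of _ _ "1 - s"] in auto)
    show "0 \<le> partial2 C s (1 - s) \<and> partial2 C s (1 - s) \<le> 1"
      by (rule derivative_unit_interval[OF partial_derivatives(2)])
        (use s copula_increment(3,4)[of _ _ s] in auto)
  qed
  then show "0 \<le> diag_partial1 s" "diag_partial1 s \<le> 1" "0 \<le> diag_partial2 s" "diag_partial2 s \<le> 1"
    by (auto simp: diag_partial1_def diag_partial2_def indicator_def)
qed

lemma diag_partial_measurable [measurable]: "diag_partial1 \<in> borel_measurable borel" "diag_partial2 \<in> borel_measurable borel"
proof -
  have cont: "continuous_on {0<..<1} (\<lambda>s. f s (1 - s))"
    if "continuous_on ({0<..<1} \<times> {0<..<1}) (\<lambda>(u, v). f u v)" for f :: "real \<Rightarrow> real \<Rightarrow> real"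
  proof -
    have "continuous_on {0<..<1} (\<lambda>s. (\<lambda>(u, v). f u v) (s, 1 - s))"
      by (rule continuous_on_compose2[OF that]) (auto intro!: continuous_intros)
    then show ?thesis by simp
  qed
  show "diag_partial1 \<in> borel_measurable borel" "diag_partial2 \<in> borel_measurable borel"
    unfolding diag_partial1_def[abs_def] diag_partial2_def[abs_def]
    using borel_measurable_continuous_on_indicator[OF _ cont, of "partial1 C"]
      borel_measurable_continuous_on_indicator[OF _ cont, of "partial2 C"] partials
    by (simp_all add: has_continuous_partials_def)
qed

text \<open>Partial derivatives alone do not control oblique increments; continuity of
  \<open>partial2\<close> at the point upgrades them to a total derivative. Along the line through
  \<open>(s, t)\<close> in direction \<open>(x, y)\<close> this is an ordinary derivative at 0,
  evaluated at the steps \<open>1 / sqrt n\<close>.\<close>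

lemma copula_local_expansion:
  assumes s: "0 < s" "s < 1" and t: "0 < t" "t < 1"
  shows "(\<lambda>n. sqrt (real n) * (C (s + x / sqrt (real n)) (t + y / sqrt (real n)) - C s t)
    - partial1 C s t * x - partial2 C s t * y) \<longlonglongrightarrow> 0"
proof -
  let ?I = "{0<..<1} :: real set"
  have open': "open (?I \<times> ?I)" by (intro open_Times) auto
  have st: "(s, t) \<in> ?I \<times> ?I" using s t by auto
  have "((\<lambda>(u, v). C u v) has_derivative
      (\<lambda>(tu, tv). partial1 C s t * tu + blinfun_apply (blinfun_mult_right (partial2 C s t)) tv))
      (at (s, t) within ?I \<times> ?I)"
  proof (rule has_derivative_partialsI)
    show "((\<lambda>u. C u t) has_derivative (*) (partial1 C s t)) (at s within ?I)"
      using partial_derivatives(1)[OF s t]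
      by (simp add: has_field_derivative_def has_derivative_at_withinI)
    show "((\<lambda>v. C u v) has_derivative blinfun_apply (blinfun_mult_right (partial2 C u v))) (at v within ?I)"
      if "u \<in> ?I" "v \<in> ?I" for u v
      using partial_derivatives(2)[of u v] that
      by (simp add: has_field_derivative_def has_derivative_at_withinI)
    have "continuous_on (?I \<times> ?I) (\<lambda>p. blinfun_mult_right (case p of (u, v) \<Rightarrow> partial2 C u v))"
      using partials unfolding has_continuous_partials_def
      by (intro bounded_linear.continuous_on[OF bounded_linear_blinfun_mult_right]) auto
    then show "continuous (at (s, t) within ?I \<times> ?I) (\<lambda>(u, v). blinfun_mult_right (partial2 C u v))"
      using st by (simp add: continuous_on_eq_continuous_within case_prod_beta')
  qed (use t in auto)
  \<comment> \<open>The point is written as the value of the line at 0, for the chain rule.\<close>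
  then have D: "((\<lambda>(u, v). C u v) has_derivative
      (\<lambda>(tu, tv). partial1 C s t * tu + partial2 C s t * tv)) (at (s + 0 * x, t + 0 * y))"
    using at_within_open[OF st open'] by simp
  have line: "((\<lambda>h. (s + h * x, t + h * y)) has_derivative (\<lambda>h. (h * x, h * y))) (at 0)"
    by (auto intro!: derivative_eq_intros)
  have "((\<lambda>h. C (s + h * x) (t + h * y)) has_derivative
      (\<lambda>h. partial1 C s t * (h * x) + partial2 C s t * (h * y))) (at 0)"
    using has_derivative_compose[OF line D] by simp
  moreover have "(\<lambda>h. partial1 C s t * (h * x) + partial2 C s t * (h * y))
      = (*) (partial1 C s t * x + partial2 C s t * y)"
    by (auto simp: algebra_simps)
  ultimately have "((\<lambda>h. C (s + h * x) (t + h * y)) has_field_derivative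
      partial1 C s t * x + partial2 C s t * y) (at 0)"
    by (simp add: has_field_derivative_def)
  then have lim: "((\<lambda>h. (C (s + h * x) (t + h * y) - C s t) / h)
      \<longlongrightarrow> partial1 C s t * x + partial2 C s t * y) (at 0)"
    by (simp add: DERIV_def)
  have "(\<lambda>n. 1 / sqrt (real n)) \<longlonglongrightarrow> 0" by real_asymp
  \<comment> \<open>At \<open>n = 0\<close> division by zero gives 0, so the sequence avoids 0 only
    eventually.\<close>
  moreover have "\<forall>\<^sub>F n in sequentially. 1 / sqrt (real n) \<noteq> 0"
    using eventually_gt_at_top[of 0] by eventually_elim simp
  ultimately have "filterlim (\<lambda>n. 1 / sqrt (real n)) (at 0) sequentially"
    by (simp add: filterlim_at)
  from filterlim_compose[OF lim this]
  have "(\<lambda>n. (C (s + 1 / sqrt (real n) * x) (t + 1 / sqrt (real n) * y) - C s t) / (1 / sqrt (real n)))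
      \<longlonglongrightarrow> partial1 C s t * x + partial2 C s t * y" .
  from tendsto_diff[OF this tendsto_const[of "partial1 C s t * x + partial2 C s t * y"]]
  show ?thesis by (simp add: mult.commute algebra_simps)
qed

subsection \<open>The remainder of the linearization\<close>

definition low_X :: "nat \<Rightarrow> real \<Rightarrow> 'a \<Rightarrow> nat set" where
  "low_X n s \<omega> = {i \<in> {1..n}. pseudo_obs (\<lambda>i. X i \<omega>) n i \<le> s}"

definition low_Y :: "nat \<Rightarrow> real \<Rightarrow> 'a \<Rightarrow> nat set" where
  "low_Y n s \<omega> = {i \<in> {1..n}. pseudo_obs (\<lambda>i. Y i \<omega>) n i \<le> s}"

text \<open>The scaled difference at \<open>(s, 1 - s)\<close> between the empirical copula built
  from ranks and its linearization, which is the empirical distribution function of \<open>P\<close>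
  minus the derivative terms; hence the plus signs. The centring value \<open>C s (1 - s)\<close>
  cancels.\<close>

definition remainder :: "nat \<Rightarrow> real \<Rightarrow> 'a \<Rightarrow> real" where
  "remainder n s \<omega> =
     sqrt (real n) * (real (card (low_X n s \<omega> \<inter> low_Y n (1 - s) \<omega>)) / real n
       - (\<Sum>i=1..n. both_le s (1 - s) (P i \<omega>)) / real n)
     + diag_partial1 s * emp_process (fst_le s) n \<omega> + diag_partial2 s * emp_process (snd_le (1 - s)) n \<omega>"

text \<open>
  The error made at the value thresholds \<open>s + x / sqrt n\<close> and \<open>1 - s + y / sqrt n\<close>: increments of
  the empirical process, and the deviation of \<open>C\<close> from its linearization.
\<close>

definition local_error :: "nat \<Rightarrow> real \<Rightarrow> real \<Rightarrow> real \<Rightarrow> 'a \<Rightarrow> real" where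
  "local_error n s x y \<omega> =
     (let u = s + x / sqrt (real n); v = 1 - s + y / sqrt (real n) in
       \<bar>emp_process (fst_le u) n \<omega> - emp_process (fst_le s) n \<omega>\<bar>
       + \<bar>emp_process (snd_le v) n \<omega> - emp_process (snd_le (1 - s)) n \<omega>\<bar>
       + \<bar>emp_process (both_le u v) n \<omega> - emp_process (both_le s (1 - s)) n \<omega>\<bar>
       + \<bar>sqrt (real n) * (C u v - C s (1 - s)) - diag_partial1 s * x - diag_partial2 s * y\<bar>)"

text \<open>\<open>F\<close> is monotone, so the value cut is a lower set for the order of
  \<open>X\<close>, just like the rank cut, even where \<open>F\<close> is flat; the same holds for
  \<open>G\<close> and \<open>Y\<close>.\<close>

lemma card_low_diff_le:
  "\<bar>real (card (low_X n s \<omega> \<inter> low_Y n t \<omega>)) - (\<Sum>i=1..n. both_le u v (P i \<omega>))\<bar>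
    \<le> \<bar>real (card (low_X n s \<omega>)) - (\<Sum>i=1..n. fst_le u (P i \<omega>))\<bar>
      + \<bar>real (card (low_Y n t \<omega>)) - (\<Sum>i=1..n. snd_le v (P i \<omega>))\<bar>"
proof -
  let ?A = "{i \<in> {1..n}. F (X i \<omega>) \<le> u}" and ?B = "{i \<in> {1..n}. G (Y i \<omega>) \<le> v}"
  have po: "pseudo_obs z n k \<le> pseudo_obs z n i" if "z k \<le> z i" for z :: "nat \<Rightarrow> real" and i k
    unfolding pseudo_obs_def by (intro divide_right_mono) (use sample_rank_mono[of z k i n] that in auto)
  have "\<bar>real (card (low_X n s \<omega> \<inter> low_Y n t \<omega>)) - real (card (?A \<inter> ?B))\<bar>
    \<le> \<bar>real (card (low_X n s \<omega>)) - real (card ?A)\<bar> + \<bar>real (card (low_Y n t \<omega>)) - real (card ?B)\<bar>"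
    by (rule card_Int_lower_sets[of "{1..n}" _ "\<lambda>i. X i \<omega>" _ _ "\<lambda>i. Y i \<omega>"])
      (auto simp: low_X_def low_Y_def intro: order_trans[OF po] order_trans[OF F_mono] order_trans[OF G_mono])
  moreover have "?A = {1..n} \<inter> {i. F (X i \<omega>) \<le> u}" "?B = {1..n} \<inter> {i. G (Y i \<omega>) \<le> v}"
    "?A \<inter> ?B = {1..n} \<inter> {i. F (X i \<omega>) \<le> u \<and> G (Y i \<omega>) \<le> v}" by auto
  ultimately show ?thesis
    by (simp add: fst_le_def snd_le_def both_le_def P_def sum_of_bool_eq)
qed

lemma sqrt_mult_average:
  "sqrt (real n) * ((\<Sum>i=1..n. g (P i \<omega>)) / real n) = emp_process g n \<omega> + sqrt (real n) * (LINT p|Q. g p)"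
proof (cases "n = 0")
  case False
  have *: "sqrt (real n) / real n = 1 / sqrt (real n)" "real n / sqrt (real n) = sqrt (real n)"
    using False by (simp_all add: real_div_sqrt field_simps flip: real_sqrt_mult)
  have "sqrt (real n) * ((\<Sum>i=1..n. g (P i \<omega>)) / real n)
      = (\<Sum>i=1..n. g (P i \<omega>)) * (sqrt (real n) / real n)" by simp
  also have "\<dots> = (\<Sum>i=1..n. g (P i \<omega>)) / sqrt (real n)" unfolding * by simp
  also have "\<dots> = emp_process g n \<omega> + real n / sqrt (real n) * (LINT p|Q. g p)"
    by (simp add: emp_process_def sum_subtractf diff_divide_distrib)
  finally show ?thesis unfolding * .
qed (simp add: emp_process_def)

text \<open>Exchanging the rank rectangle for the value rectangle costs the mismatch of the marginal
  counts, which on the scale \<open>sqrt n\<close> is \<open>\<bar>W + x\<bar>\<close>, with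
  \<open>W\<close> the empirical process, up to a process increment and \<open>1 / sqrt n\<close>.
  Moving the value rectangle back to \<open>(s, 1 - s)\<close> costs increments of the process and
  of \<open>C\<close>. The factor 2 arises because \<open>W + x\<close> occurs in the mismatch and
  again when \<open>x\<close> replaces \<open>- W\<close> in the derivative term.\<close>

lemma abs_remainder_le:
  assumes n: "n > 0" and s: "0 < s" "s < 1"
    and u: "0 \<le> s + x / sqrt (real n)" "s + x / sqrt (real n) \<le> 1"
    and v: "0 \<le> 1 - s + y / sqrt (real n)" "1 - s + y / sqrt (real n) \<le> 1"
    and inj: "inj_on (\<lambda>i. X i \<omega>) {1..n}" "inj_on (\<lambda>i. Y i \<omega>) {1..n}"
  shows "\<bar>remainder n s \<omega>\<bar> \<le> 2 / sqrt (real n) + 2 * \<bar>emp_process (fst_le s) n \<omega> + x\<bar>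
    + 2 * \<bar>emp_process (snd_le (1 - s)) n \<omega> + y\<bar> + local_error n s x y \<omega>"
proof -
  define r where "r = sqrt (real n)"
  have r: "r > 0" "r * r = real n" using n by (simp_all add: r_def)
  define U where "U = s + x / r"
  define V where "V = 1 - s + y / r"
  define W1 where "W1 = emp_process (fst_le s) n \<omega>"
  define W2 where "W2 = emp_process (snd_le (1 - s)) n \<omega>"
  define h where "h = real (card (low_X n s \<omega> \<inter> low_Y n (1 - s) \<omega>)) / real n"
  define p where "p = real (card (low_X n s \<omega>)) / real n"
  define q where "q = real (card (low_Y n (1 - s) \<omega>)) / real n"
  define Hs where "Hs = (\<Sum>i=1..n. both_le s (1 - s) (P i \<omega>)) / real n"
  define H where "H = (\<Sum>i=1..n. both_le U V (P i \<omega>)) / real n"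
  define Fn where "Fn = (\<Sum>i=1..n. fst_le U (P i \<omega>)) / real n"
  define Gn where "Gn = (\<Sum>i=1..n. snd_le V (P i \<omega>)) / real n"
  have UV: "0 \<le> U" "U \<le> 1" "0 \<le> V" "V \<le> 1" using u v by (simp_all add: U_def V_def r_def)
  have HH: "r * H = emp_process (both_le U V) n \<omega> + r * C U V"
    and HHs: "r * Hs = emp_process (both_le s (1 - s)) n \<omega> + r * C s (1 - s)"
    and FF: "r * Fn = emp_process (fst_le U) n \<omega> + r * U"
    and GG: "r * Gn = emp_process (snd_le V) n \<omega> + r * V"
    unfolding H_def Hs_def Fn_def Gn_def r_def sqrt_mult_average
    using UV s by (simp_all add: integral_indicators)
  have rU: "r * U = r * s + x" and rV: "r * V = r * (1 - s) + y"
    using r by (simp_all add: U_def V_def algebra_simps)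
  have r_abs: "\<bar>r * a - r * b\<bar> = r * \<bar>a - b\<bar>" for a b
    using r by (simp add: right_diff_distrib[symmetric] abs_mult)
  have "\<bar>h - H\<bar> \<le> \<bar>p - Fn\<bar> + \<bar>q - Gn\<bar>"
  proof -
    have "\<bar>h - H\<bar> = \<bar>real (card (low_X n s \<omega> \<inter> low_Y n (1 - s) \<omega>)) - (\<Sum>i=1..n. both_le U V (P i \<omega>))\<bar> / real n"
      by (simp add: h_def H_def diff_divide_distrib[symmetric] abs_divide)
    also have "\<dots> \<le> (\<bar>real (card (low_X n s \<omega>)) - (\<Sum>i=1..n. fst_le U (P i \<omega>))\<bar>
      + \<bar>real (card (low_Y n (1 - s) \<omega>)) - (\<Sum>i=1..n. snd_le V (P i \<omega>))\<bar>) / real n"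
      by (intro divide_right_mono card_low_diff_le) simp
    also have "\<dots> = \<bar>p - Fn\<bar> + \<bar>q - Gn\<bar>"
      by (simp add: p_def q_def Fn_def Gn_def diff_divide_distrib[symmetric] add_divide_distrib abs_divide)
    finally show ?thesis .
  qed
  then have "r * \<bar>h - H\<bar> \<le> r * (\<bar>p - Fn\<bar> + \<bar>q - Gn\<bar>)"
    using r by (intro mult_left_mono) auto
  then have 1: "\<bar>r * h - r * H\<bar> \<le> \<bar>r * p - r * Fn\<bar> + \<bar>r * q - r * Gn\<bar>"
    by (simp only: r_abs distrib_left)
  have scale: "\<bar>r * a - r * b\<bar> \<le> 1 / r" if "\<bar>a - b\<bar> \<le> 1 / real n" for a b
  proof -
    have "\<bar>r * a - r * b\<bar> \<le> r * (1 / real n)" unfolding r_abs using r that by (intro mult_left_mono) auto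
    also have "\<dots> = 1 / r" using r n by (simp add: field_simps)
    finally show ?thesis .
  qed
  have 2: "\<bar>r * p - r * s\<bar> \<le> 1 / r" "\<bar>r * q - r * (1 - s)\<bar> \<le> 1 / r"
    unfolding p_def q_def low_X_def low_Y_def using s n inj by (intro scale card_pseudo_obs_le; simp)+
  have d1: "\<bar>diag_partial1 s * (W1 + x)\<bar> \<le> \<bar>W1 + x\<bar>" "\<bar>diag_partial2 s * (W2 + y)\<bar> \<le> \<bar>W2 + y\<bar>"
    using diag_partial_bounds[of s] by (simp_all add: abs_mult mult_left_le_one_le)
  have 3: "\<bar>r * p - r * Fn\<bar> \<le> 1 / r + \<bar>W1 + x\<bar> + \<bar>emp_process (fst_le U) n \<omega> - W1\<bar>"
    using 2(1) FF rU by linarith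
  have 4: "\<bar>r * q - r * Gn\<bar> \<le> 1 / r + \<bar>W2 + y\<bar> + \<bar>emp_process (snd_le V) n \<omega> - W2\<bar>"
    using 2(2) GG rV by linarith
  have tri: "\<bar>a + b + c + d + e\<bar> \<le> \<bar>a\<bar> + \<bar>b\<bar> + \<bar>c\<bar> + \<bar>d\<bar> + \<bar>e\<bar>" for a b c d e :: real
    by linarith
  \<comment> \<open>Adding and subtracting \<open>r * H\<close> and the terms linear in
    \<open>x\<close> and \<open>y\<close> splits the remainder into the exchange, a process
    increment, the expansion of \<open>C\<close> and two derivative mismatches.\<close>
  have "remainder n s \<omega> = (r * h - r * H)
      + (emp_process (both_le U V) n \<omega> - emp_process (both_le s (1 - s)) n \<omega>)
      + (r * (C U V - C s (1 - s)) - diag_partial1 s * x - diag_partial2 s * y)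
      + diag_partial1 s * (W1 + x) + diag_partial2 s * (W2 + y)"
    using HH HHs unfolding remainder_def h_def[symmetric] Hs_def[symmetric] r_def[symmetric] W1_def W2_def
    by (simp add: algebra_simps)
  then have "\<bar>remainder n s \<omega>\<bar> \<le> \<bar>r * h - r * H\<bar>
      + \<bar>emp_process (both_le U V) n \<omega> - emp_process (both_le s (1 - s)) n \<omega>\<bar>
      + \<bar>r * (C U V - C s (1 - s)) - diag_partial1 s * x - diag_partial2 s * y\<bar>
      + \<bar>diag_partial1 s * (W1 + x)\<bar> + \<bar>diag_partial2 s * (W2 + y)\<bar>"
    by (simp only: tri)
  also have "\<dots> \<le> (1 / r + \<bar>W1 + x\<bar> + \<bar>emp_process (fst_le U) n \<omega> - W1\<bar>
        + (1 / r + \<bar>W2 + y\<bar> + \<bar>emp_process (snd_le V) n \<omega> - W2\<bar>))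
      + \<bar>emp_process (both_le U V) n \<omega> - emp_process (both_le s (1 - s)) n \<omega>\<bar>
      + \<bar>r * (C U V - C s (1 - s)) - diag_partial1 s * x - diag_partial2 s * y\<bar> + \<bar>W1 + x\<bar> + \<bar>W2 + y\<bar>"
    by (intro add_mono order_trans[OF 1] 3 4 d1 order_refl)
  finally have "\<bar>remainder n s \<omega>\<bar> \<le> \<dots>" .
  moreover have "local_error n s x y \<omega> = \<bar>emp_process (fst_le U) n \<omega> - W1\<bar> + \<bar>emp_process (snd_le V) n \<omega> - W2\<bar>
       + \<bar>emp_process (both_le U V) n \<omega> - emp_process (both_le s (1 - s)) n \<omega>\<bar>
       + \<bar>r * (C U V - C s (1 - s)) - diag_partial1 s * x - diag_partial2 s * y\<bar>"
    by (simp add: local_error_def Let_def U_def V_def r_def W1_def W2_def)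
  moreover have "a \<le> 2 * i + 2 * w + 2 * w' + l"
    if "a \<le> (i + w + e + (i + w' + e')) + b + d + w + w'" "l = e + e' + b + d"
    for a i w w' e e' b d l :: real
    using that by linarith
  ultimately have "\<bar>remainder n s \<omega>\<bar> \<le> 2 * (1 / r) + 2 * \<bar>W1 + x\<bar> + 2 * \<bar>W2 + y\<bar> + local_error n s x y \<omega>"
    by blast
  then show ?thesis
    unfolding r_def[symmetric] W1_def[symmetric] W2_def[symmetric] by (simp only: times_divide_eq_right mult_1_right)
qed

lemma local_error_nonneg: "0 \<le> local_error n s x y \<omega>"
  by (simp add: local_error_def Let_def)

text \<open>At \<open>x = y = 0\<close> every increment in \<open>local_error\<close> vanishes. The
  resulting bound does not tend to 0, but its mean is bounded uniformly in \<open>s\<close>.\<close>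

lemma abs_remainder_le_emp_process:
  assumes "n > 0" "0 < s" "s < 1"
    and "inj_on (\<lambda>i. X i \<omega>) {1..n}" "inj_on (\<lambda>i. Y i \<omega>) {1..n}"
  shows "\<bar>remainder n s \<omega>\<bar> \<le> 2 / sqrt (real n) + 2 * \<bar>emp_process (fst_le s) n \<omega>\<bar> + 2 * \<bar>emp_process (snd_le (1 - s)) n \<omega>\<bar>"
  using abs_remainder_le[of n s 0 0 \<omega>] assms by (simp add: local_error_def)

section \<open>A finite mesh of thresholds\<close>

text \<open>One parameter governs both discretization errors, the spacing \<open>1 / N\<close> and
  the range \<open>N\<close>, whence indices up to the square of \<open>N\<close>.\<close>

definition mesh :: "nat \<Rightarrow> (real \<times> real) set" where
  "mesh N = (let J = (\<lambda>j. real_of_int j / real N) ` {- int (N\<^sup>2)..int (N\<^sup>2)} in J \<times> J)"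

lemma finite_mesh [simp]: "finite (mesh N)"
  by (simp add: mesh_def Let_def)

lemma abs_mesh_le: "p \<in> mesh N \<Longrightarrow> \<bar>fst p\<bar> \<le> real N \<and> \<bar>snd p\<bar> \<le> real N"
proof -
  have *: "\<bar>real_of_int j / real N\<bar> \<le> real N" if "j \<in> {- int (N\<^sup>2)..int (N\<^sup>2)}" for j
  proof (cases "N = 0")
    case False
    have "\<bar>j\<bar> \<le> int (N\<^sup>2)" using that by auto
    then have "\<bar>real_of_int j\<bar> \<le> real N * real N"
      by (metis (mono_tags, lifting) of_int_abs of_int_le_iff of_int_of_nat_eq of_nat_mult power2_eq_square)
    then show ?thesis using False by (simp add: abs_divide divide_le_eq)
  qed simp
  assume "p \<in> mesh N"
  then show ?thesis using * by (auto simp: mesh_def Let_def)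
qed

lemma mesh_near:
  assumes N: "N > 0" and a: "\<bar>a\<bar> \<le> real N" "\<bar>b\<bar> \<le> real N"
  obtains x y where "(x, y) \<in> mesh N" "\<bar>a + x\<bar> \<le> 1 / real N" "\<bar>b + y\<bar> \<le> 1 / real N"
proof -
  have *: "\<exists>j \<in> {- int (N\<^sup>2)..int (N\<^sup>2)}. \<bar>c + real_of_int j / real N\<bar> \<le> 1 / real N"
    if c: "\<bar>c\<bar> \<le> real N" for c :: real
  proof -
    \<comment> \<open>The mesh point approximates \<open>- c\<close>, and rounding down keeps the
      error below \<open>1 / N\<close>.\<close>
    define j where "j = \<lfloor>- c * real N\<rfloor>"
    have j: "real_of_int j \<le> - c * real N" "- c * real N < real_of_int j + 1"
      unfolding j_def by linarith+
    have "\<bar>c * real N\<bar> \<le> real N * real N" using c by (simp add: abs_mult mult_right_mono)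
    then have cN: "- real (N\<^sup>2) \<le> - c * real N" "- c * real N \<le> real (N\<^sup>2)"
      by (simp_all add: power2_eq_square abs_le_iff)
    have "- int (N\<^sup>2) \<le> j" unfolding j_def using cN by (simp add: le_floor_iff)
    moreover have "j \<le> int (N\<^sup>2)"
    proof -
      have "real_of_int j \<le> real_of_int (int (N\<^sup>2))" using j cN by simp
      then show ?thesis by (simp only: of_int_le_iff)
    qed
    moreover have "\<bar>c + real_of_int j / real N\<bar> \<le> 1 / real N"
    proof -
      have "c + real_of_int j / real N = (c * real N + real_of_int j) / real N" using N by (simp add: field_simps)
      moreover have "\<bar>c * real N + real_of_int j\<bar> \<le> 1" using j by linarith
      ultimately show ?thesis by (simp add: abs_divide divide_right_mono)
    qed
    ultimately show ?thesis by auto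
  qed
  from *[OF a(1)] *[OF a(2)] that show ?thesis by (fastforce simp: mesh_def Let_def)
qed

text \<open>
  If the empirical process leaves the range \<open>[-N, N]\<close> of the mesh, the bound with thresholds at
  \<open>s\<close> itself (\<open>x = y = 0\<close>) is used, and \<open>\<bar>W\<bar> \<le> W\<^sup>2 / N\<close> makes it small in mean.
\<close>

lemma abs_remainder_le_mesh:
  assumes N: "N > 0" and n: "n > 0" and s: "0 < s" "s < 1"
    and small: "real N / sqrt (real n) \<le> min s (1 - s)"
    and inj: "inj_on (\<lambda>i. X i \<omega>) {1..n}" "inj_on (\<lambda>i. Y i \<omega>) {1..n}"
  shows "\<bar>remainder n s \<omega>\<bar> \<le> 2 / sqrt (real n) + 4 / real N
    + 4 * ((emp_process (fst_le s) n \<omega>)\<^sup>2 + (emp_process (snd_le (1 - s)) n \<omega>)\<^sup>2) / real N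
    + (\<Sum>(x, y)\<in>mesh N. local_error n s x y \<omega>)"
proof -
  define W1 where "W1 = emp_process (fst_le s) n \<omega>"
  define W2 where "W2 = emp_process (snd_le (1 - s)) n \<omega>"
  have sum_nonneg: "0 \<le> (\<Sum>(x, y)\<in>mesh N. local_error n s x y \<omega>)"
    by (auto intro!: sum_nonneg local_error_nonneg)
  have sq_nonneg: "0 \<le> 4 * (W1\<^sup>2 + W2\<^sup>2) / real N" by simp
  show ?thesis
  proof (cases "\<bar>W1\<bar> \<le> real N \<and> \<bar>W2\<bar> \<le> real N")
    case True
    then obtain x y where xy: "(x, y) \<in> mesh N" "\<bar>W1 + x\<bar> \<le> 1 / real N" "\<bar>W2 + y\<bar> \<le> 1 / real N"
      using mesh_near[OF N] by blast
    \<comment> \<open>All mesh thresholds stay in the unit interval, because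
      \<open>N / sqrt n\<close> is at most the distance from \<open>s\<close> to its ends.\<close>
    have near: "\<bar>z / sqrt (real n)\<bar> \<le> min s (1 - s)" if "\<bar>z\<bar> \<le> real N" for z
    proof -
      have "\<bar>z / sqrt (real n)\<bar> \<le> real N / sqrt (real n)"
        using that by (simp add: abs_divide divide_right_mono)
      with small show ?thesis by linarith
    qed
    have "\<bar>remainder n s \<omega>\<bar> \<le> 2 / sqrt (real n) + 2 * \<bar>W1 + x\<bar> + 2 * \<bar>W2 + y\<bar> + local_error n s x y \<omega>"
      unfolding W1_def W2_def
    proof (rule abs_remainder_le[OF n s _ _ _ _ inj])
      have "\<bar>x / sqrt (real n)\<bar> \<le> min s (1 - s)" "\<bar>y / sqrt (real n)\<bar> \<le> min s (1 - s)"
        using abs_mesh_le[OF xy(1)] near by auto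
      then show "0 \<le> s + x / sqrt (real n)" "s + x / sqrt (real n) \<le> 1"
        "0 \<le> 1 - s + y / sqrt (real n)" "1 - s + y / sqrt (real n) \<le> 1"
        by linarith+
    qed
    \<comment> \<open>The point \<open>(x, y)\<close> depends on \<open>\<omega>\<close>. As the
      errors are nonnegative, the sum over the whole mesh dominates, and its expectation is a finite
      sum over deterministic thresholds.\<close>
    also have "\<dots> \<le> 2 / sqrt (real n) + 2 * (1 / real N) + 2 * (1 / real N)
        + (\<Sum>(x, y)\<in>mesh N. local_error n s x y \<omega>)"
      using member_le_sum[OF xy(1), of "\<lambda>(x, y). local_error n s x y \<omega>"]
      by (intro add_mono mult_left_mono xy order_refl) (auto simp: local_error_nonneg)
    also have "\<dots> = 2 / sqrt (real n) + 4 / real N + (\<Sum>(x, y)\<in>mesh N. local_error n s x y \<omega>)"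
      by simp
    also have "\<dots> \<le> 2 / sqrt (real n) + 4 / real N + 4 * (W1\<^sup>2 + W2\<^sup>2) / real N
        + (\<Sum>(x, y)\<in>mesh N. local_error n s x y \<omega>)"
      using sq_nonneg by simp
    finally show ?thesis unfolding W1_def W2_def .
  next
    case False
    \<comment> \<open>For the larger of the two, \<open>N * \<bar>a\<bar> \<le> a\<^sup>2\<close>;
      including the smaller one costs a factor 2.\<close>
    have *: "\<bar>a\<bar> + \<bar>b\<bar> \<le> 2 * (a\<^sup>2 + b\<^sup>2) / real N" if "\<bar>a\<bar> > real N" "\<bar>b\<bar> \<le> \<bar>a\<bar>" for a b
    proof -
      have "real N * \<bar>a\<bar> \<le> \<bar>a\<bar> * \<bar>a\<bar>" using that by (intro mult_right_mono) auto
      then have "real N * (\<bar>a\<bar> + \<bar>b\<bar>) \<le> 2 * a\<^sup>2"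
        using mult_left_mono[OF that(2), of "real N"] by (simp add: power2_eq_square distrib_left)
      also have "\<dots> \<le> 2 * (a\<^sup>2 + b\<^sup>2)" by simp
      finally show ?thesis using N by (simp add: le_divide_eq mult.commute)
    qed
    have "\<bar>W1\<bar> + \<bar>W2\<bar> \<le> 2 * (W1\<^sup>2 + W2\<^sup>2) / real N"
    proof (cases "\<bar>W2\<bar> \<le> \<bar>W1\<bar>")
      case True
      then show ?thesis using *[of W1 W2] False by linarith
    next
      case False': False
      with False have "real N < \<bar>W2\<bar>" by linarith
      with *[of W2 W1] False' show ?thesis by (simp add: add.commute)
    qed
    moreover have "\<bar>remainder n s \<omega>\<bar> \<le> 2 / sqrt (real n) + 2 * \<bar>W1\<bar> + 2 * \<bar>W2\<bar>"
      unfolding W1_def W2_def by (rule abs_remainder_le_emp_process[OF n s inj])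
    moreover have "0 \<le> 4 / real N" by simp
    moreover have "4 * (W1\<^sup>2 + W2\<^sup>2) / real N = 2 * (2 * (W1\<^sup>2 + W2\<^sup>2) / real N)" by simp
    ultimately show ?thesis
      using sum_nonneg unfolding W1_def[symmetric] W2_def[symmetric] by linarith
  qed
qed

text \<open>Three process increments, each at most the root of a distance of order
  \<open>1 / sqrt n\<close> between thresholds, plus the deterministic error of the expansion. As
  \<open>s\<close> is interior, the thresholds are eventually in the unit interval, where these
  bounds apply.\<close>

lemma expectation_local_error_tendsto:
  assumes s: "0 < s" "s < 1"
  shows "(\<lambda>n. expectation (local_error n s x y)) \<longlonglongrightarrow> 0"
proof (rule Lim_null_comparison)
  define D where "D n = sqrt (real n) * (C (s + x / sqrt (real n)) (1 - s + y / sqrt (real n)) - C s (1 - s))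
    - partial1 C s (1 - s) * x - partial2 C s (1 - s) * y" for n
  define z where "z n = \<bar>x\<bar> / sqrt (real n) + \<bar>y\<bar> / sqrt (real n)" for n
  have "D \<longlonglongrightarrow> 0"
    unfolding D_def using copula_local_expansion[OF s, of "1 - s" x y] s by simp
  then have "(\<lambda>n. \<bar>D n\<bar>) \<longlonglongrightarrow> 0" by (rule tendsto_rabs_zero)
  moreover have "z \<longlonglongrightarrow> 0" unfolding z_def by real_asymp
  then have "(\<lambda>n. sqrt (z n)) \<longlonglongrightarrow> 0" using tendsto_real_sqrt[of z 0] by simp
  ultimately show "(\<lambda>n. 3 * sqrt (z n) + \<bar>D n\<bar>) \<longlonglongrightarrow> 0"
    using tendsto_add[OF tendsto_mult_left[of _ 0 _ 3], of "\<lambda>n. sqrt (z n)" _ "\<lambda>n. \<bar>D n\<bar>" 0] by simp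
  have lim: "(\<lambda>n. s + x / sqrt (real n)) \<longlonglongrightarrow> s" "(\<lambda>n. 1 - s + y / sqrt (real n)) \<longlonglongrightarrow> 1 - s"
    by real_asymp+
  have "\<forall>\<^sub>F n in sequentially. 0 < s + x / sqrt (real n)" "\<forall>\<^sub>F n in sequentially. s + x / sqrt (real n) < 1"
    "\<forall>\<^sub>F n in sequentially. 0 < 1 - s + y / sqrt (real n)" "\<forall>\<^sub>F n in sequentially. 1 - s + y / sqrt (real n) < 1"
    using order_tendstoD(1)[OF lim(1), of 0] order_tendstoD(2)[OF lim(1), of 1]
      order_tendstoD(1)[OF lim(2), of 0] order_tendstoD(2)[OF lim(2), of 1] s by simp_all
  then show "\<forall>\<^sub>F n in sequentially. norm (expectation (local_error n s x y)) \<le> 3 * sqrt (z n) + \<bar>D n\<bar>"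
  proof eventually_elim
    fix n
    define u where "u = s + x / sqrt (real n)"
    define v where "v = 1 - s + y / sqrt (real n)"
    assume "0 < s + x / sqrt (real n)" "s + x / sqrt (real n) < 1"
      "0 < 1 - s + y / sqrt (real n)" "1 - s + y / sqrt (real n) < 1"
    then have uv: "u \<in> {0..1}" "s \<in> {0..1}" "v \<in> {0..1}" "1 - s \<in> {0..1}"
      using s by (auto simp: u_def v_def)
    have int: "integrable M (\<lambda>\<omega>. \<bar>emp_process (fst_le u) n \<omega> - emp_process (fst_le s) n \<omega>\<bar>)"
      "integrable M (\<lambda>\<omega>. \<bar>emp_process (snd_le v) n \<omega> - emp_process (snd_le (1 - s)) n \<omega>\<bar>)"
      "integrable M (\<lambda>\<omega>. \<bar>emp_process (both_le u v) n \<omega> - emp_process (both_le s (1 - s)) n \<omega>\<bar>)"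
      by (auto intro!: integrable_abs Bochner_Integration.integrable_diff
          expectation_abs_emp_process_le(1)[where B=1] simp: abs_indicators_le)
    have D: "sqrt (real n) * (C u v - C s (1 - s)) - diag_partial1 s * x - diag_partial2 s * y = D n"
      using s by (simp add: D_def diag_partial1_def diag_partial2_def u_def v_def)
    have "expectation (local_error n s x y)
      = expectation (\<lambda>\<omega>. \<bar>emp_process (fst_le u) n \<omega> - emp_process (fst_le s) n \<omega>\<bar>)
       + expectation (\<lambda>\<omega>. \<bar>emp_process (snd_le v) n \<omega> - emp_process (snd_le (1 - s)) n \<omega>\<bar>)
       + expectation (\<lambda>\<omega>. \<bar>emp_process (both_le u v) n \<omega> - emp_process (both_le s (1 - s)) n \<omega>\<bar>) + \<bar>D n\<bar>"
      unfolding local_error_def[abs_def] Let_def u_def[symmetric] v_def[symmetric] D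
      using int by (simp add: prob_space)
    also have "\<dots> \<le> sqrt \<bar>u - s\<bar> + sqrt \<bar>v - (1 - s)\<bar> + sqrt (\<bar>u - s\<bar> + \<bar>v - (1 - s)\<bar>) + \<bar>D n\<bar>"
      by (intro add_mono expectation_abs_emp_process_increments[OF uv] order_refl)
    also have "\<dots> \<le> sqrt (z n) + sqrt (z n) + sqrt (z n) + \<bar>D n\<bar>"
      by (intro add_mono real_sqrt_le_mono) (simp_all add: u_def v_def z_def abs_divide)
    finally show "norm (expectation (local_error n s x y)) \<le> 3 * sqrt (z n) + \<bar>D n\<bar>"
      using Bochner_Integration.integral_nonneg[of M "local_error n s x y"] by (simp add: local_error_nonneg)
  qed
qed

section \<open>Joint measurability in level and outcome\<close>

lemma rv_pseudo_obs:
  assumes "i \<in> {1..n}"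
  shows "random_variable borel (\<lambda>\<omega>. pseudo_obs (\<lambda>i. X i \<omega>) n i)"
    and "random_variable borel (\<lambda>\<omega>. pseudo_obs (\<lambda>i. Y i \<omega>) n i)"
proof -
  have *: "random_variable borel (\<lambda>\<omega>. pseudo_obs (\<lambda>i. Z i \<omega>) n i)"
    if rv: "\<And>k. k \<in> {1..n} \<Longrightarrow> random_variable borel (Z k)" for Z :: "nat \<Rightarrow> 'a \<Rightarrow> real"
  proof -
    have [measurable]: "random_variable borel (Z i)" using rv assms .
    have "(\<lambda>\<omega>. of_bool (Z k \<omega> \<le> Z i \<omega>) :: real) \<in> borel_measurable M" if "k \<in> {1..n}" for k
    proof -
      have [measurable]: "random_variable borel (Z k)" using rv that .
      show ?thesis by measurable
    qed
    moreover have "pseudo_obs (\<lambda>i. Z i \<omega>) n i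
        = (\<Sum>k=1..n. of_bool (Z k \<omega> \<le> Z i \<omega>)) / (real n + 1)" for \<omega>
    proof -
      have "{k \<in> {1..n}. Z k \<omega> \<le> Z i \<omega>} = {1..n} \<inter> {k. Z k \<omega> \<le> Z i \<omega>}" by auto
      then show ?thesis by (simp add: pseudo_obs_def sample_rank_def sum_of_bool_eq del: atLeastAtMost_iff)
    qed
    ultimately show ?thesis
      by (simp only:) (intro borel_measurable_divide borel_measurable_sum borel_measurable_const)
  qed
  show "random_variable borel (\<lambda>\<omega>. pseudo_obs (\<lambda>i. X i \<omega>) n i)"
    "random_variable borel (\<lambda>\<omega>. pseudo_obs (\<lambda>i. Y i \<omega>) n i)"
    by (rule *; simp add: rv_X rv_Y)+
qed

lemma card_low_eq_sum:
  "real (card (low_X n s \<omega> \<inter> low_Y n (1 - s) \<omega>))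
    = (\<Sum>i=1..n. of_bool (pseudo_obs (\<lambda>i. X i \<omega>) n i \<le> s \<and> pseudo_obs (\<lambda>i. Y i \<omega>) n i \<le> 1 - s))"
proof -
  have "low_X n s \<omega> \<inter> low_Y n (1 - s) \<omega> = {1..n} \<inter>
    {i. pseudo_obs (\<lambda>i. X i \<omega>) n i \<le> s \<and> pseudo_obs (\<lambda>i. Y i \<omega>) n i \<le> 1 - s}"
    by (auto simp: low_X_def low_Y_def)
  then show ?thesis by (simp add: sum_of_bool_eq)
qed

text \<open>The closed forms \<open>s\<close> and \<open>1 - s\<close> hold on the unit interval
  only, so measurability on the whole line is obtained from that of parameter integrals.\<close>

lemma integral_indicators_measurable:
  "(\<lambda>s. LINT p|Q. fst_le s p) \<in> borel_measurable borel"
  "(\<lambda>s. LINT p|Q. snd_le (1 - s) p) \<in> borel_measurable borel"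
proof -
  have "(\<lambda>(s, p). fst_le s p) \<in> borel_measurable (borel \<Otimes>\<^sub>M Q)"
    "(\<lambda>(s, p). snd_le (1 - s) p) \<in> borel_measurable (borel \<Otimes>\<^sub>M Q)"
    unfolding fst_le_def snd_le_def measurable_cong_sets[OF sets_pair_measure_cong[OF refl sets_Q] refl]
      borel_prod[symmetric]
    by measurable
  from Q.borel_measurable_lebesgue_integral[OF this(1)] Q.borel_measurable_lebesgue_integral[OF this(2)]
  show "(\<lambda>s. LINT p|Q. fst_le s p) \<in> borel_measurable borel"
    "(\<lambda>s. LINT p|Q. snd_le (1 - s) p) \<in> borel_measurable borel" .
qed

lemma indicators_P_measurable:
  assumes "i \<in> {1..n}"
  shows "(\<lambda>z. fst_le (fst z) (P i (snd z))) \<in> borel_measurable (unit_law \<Otimes>\<^sub>M M)"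
    "(\<lambda>z. snd_le (1 - fst z) (P i (snd z))) \<in> borel_measurable (unit_law \<Otimes>\<^sub>M M)"
    "(\<lambda>z. both_le (fst z) (1 - fst z) (P i (snd z))) \<in> borel_measurable (unit_law \<Otimes>\<^sub>M M)"
proof -
  have [measurable]: "random_variable borel (X i)" "random_variable borel (Y i)"
    using assms by (auto intro: rv_X rv_Y)
  show "(\<lambda>z. fst_le (fst z) (P i (snd z))) \<in> borel_measurable (unit_law \<Otimes>\<^sub>M M)"
    "(\<lambda>z. snd_le (1 - fst z) (P i (snd z))) \<in> borel_measurable (unit_law \<Otimes>\<^sub>M M)"
    "(\<lambda>z. both_le (fst z) (1 - fst z) (P i (snd z))) \<in> borel_measurable (unit_law \<Otimes>\<^sub>M M)"
    unfolding fst_le_def snd_le_def both_le_def P_def fst_conv snd_conv by measurable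
qed

lemma remainder_measurable: "(\<lambda>(s, \<omega>). remainder n s \<omega>) \<in> borel_measurable (unit_law \<Otimes>\<^sub>M M)"
proof -
  have fst_meas: "fst \<in> measurable (unit_law \<Otimes>\<^sub>M M) borel"
    by (metis measurable_cong_sets measurable_fst sets_unit_law)
  have po: "(\<lambda>z. of_bool (pseudo_obs (\<lambda>i. X i (snd z)) n i \<le> fst z \<and>
      pseudo_obs (\<lambda>i. Y i (snd z)) n i \<le> 1 - fst z) :: real) \<in> borel_measurable (unit_law \<Otimes>\<^sub>M M)"
    if "i \<in> {1..n}" for i
  proof -
    note rv_pseudo_obs[OF that, measurable]
    show ?thesis by measurable
  qed
  have emp_process1: "(\<lambda>z. emp_process (fst_le (fst z)) n (snd z)) \<in> borel_measurable (unit_law \<Otimes>\<^sub>M M)"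
    and emp_process2: "(\<lambda>z. emp_process (snd_le (1 - fst z)) n (snd z)) \<in> borel_measurable (unit_law \<Otimes>\<^sub>M M)"
    unfolding emp_process_def
    by (intro borel_measurable_divide borel_measurable_sum borel_measurable_diff borel_measurable_const
        indicators_P_measurable measurable_compose[OF fst_meas] integral_indicators_measurable; assumption)+
  have "(\<lambda>z. remainder n (fst z) (snd z)) \<in> borel_measurable (unit_law \<Otimes>\<^sub>M M)"
    unfolding remainder_def card_low_eq_sum
    by (intro borel_measurable_add borel_measurable_times borel_measurable_diff borel_measurable_divide
        borel_measurable_sum borel_measurable_const po indicators_P_measurable emp_process1 emp_process2
        measurable_compose[OF fst_meas] diag_partial_measurable; assumption)
  then show ?thesis by (simp add: case_prod_beta')
qed

lemma abs_emp_process_le: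
  fixes g :: "real \<times> real \<Rightarrow> real"
  assumes g: "g \<in> borel_measurable borel" "\<And>p. \<bar>g p\<bar> \<le> 1"
  shows "\<bar>emp_process g n \<omega>\<bar> \<le> 2 * sqrt (real n)"
proof -
  have "\<bar>LINT p|Q. g p\<bar> \<le> (LINT p|Q. \<bar>g p\<bar>)" by (rule integral_abs_bound)
  also have "\<dots> \<le> (LINT p|Q. 1)"
    using integrable_Q[OF g] g by (intro integral_mono) auto
  finally have m: "\<bar>LINT p|Q. g p\<bar> \<le> 1" by simp
  have "\<bar>\<Sum>i=1..n. g (P i \<omega>) - (LINT p|Q. g p)\<bar> \<le> (\<Sum>i=1..n. 2)"
  proof (rule order_trans[OF sum_abs], rule sum_mono)
    fix i show "\<bar>g (P i \<omega>) - (LINT p|Q. g p)\<bar> \<le> 2" using m g(2)[of "P i \<omega>"] by linarith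
  qed
  then have "\<bar>emp_process g n \<omega>\<bar> \<le> (2 * real n) / sqrt (real n)"
    unfolding emp_process_def abs_divide by (simp add: divide_right_mono)
  also have "\<dots> = 2 * sqrt (real n)" 
    by (simp only: times_divide_eq_right[symmetric] real_div_sqrt of_nat_0_le_iff)
  finally show ?thesis .
qed

text \<open>Valid for every \<open>s\<close> and \<open>\<omega>\<close>, ties included, but growing
  with \<open>n\<close>: it serves integrability alone. The three terms contribute at most 1, 2 and
  2 times \<open>sqrt n\<close>.\<close>

lemma abs_remainder_le_const: "\<bar>remainder n s \<omega>\<bar> \<le> 6 * sqrt (real n)"
proof -
  have avg: "0 \<le> (\<Sum>i=1..n. f i) / real n \<and> (\<Sum>i=1..n. f i) / real n \<le> 1"
    if "\<And>i. 0 \<le> f i \<and> f i \<le> 1" for f :: "nat \<Rightarrow> real"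
  proof -
    have "(\<Sum>i=1..n. f i) \<le> (\<Sum>i=1..n. 1)" using that by (intro sum_mono) auto
    then have "(\<Sum>i=1..n. f i) \<le> real n" by simp
    then show ?thesis using that by (auto intro!: divide_nonneg_nonneg sum_nonneg simp: divide_le_eq_1)
  qed
  have "\<bar>real (card (low_X n s \<omega> \<inter> low_Y n (1 - s) \<omega>)) / real n
       - (\<Sum>i=1..n. both_le s (1 - s) (P i \<omega>)) / real n\<bar> \<le> 1"
  proof -
    have "0 \<le> real (card (low_X n s \<omega> \<inter> low_Y n (1 - s) \<omega>)) / real n
        \<and> real (card (low_X n s \<omega> \<inter> low_Y n (1 - s) \<omega>)) / real n \<le> 1"
      unfolding card_low_eq_sum by (rule avg) auto
    moreover have "0 \<le> (\<Sum>i=1..n. both_le s (1 - s) (P i \<omega>)) / real n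
        \<and> (\<Sum>i=1..n. both_le s (1 - s) (P i \<omega>)) / real n \<le> 1"
      by (rule avg) (auto simp: both_le_def)
    ultimately show ?thesis by linarith
  qed
  then have "\<bar>sqrt (real n) * (real (card (low_X n s \<omega> \<inter> low_Y n (1 - s) \<omega>)) / real n
       - (\<Sum>i=1..n. both_le s (1 - s) (P i \<omega>)) / real n)\<bar> \<le> sqrt (real n) * 1"
    unfolding abs_mult by (intro mult_mono) auto
  moreover have "\<bar>diag_partial1 s * emp_process (fst_le s) n \<omega>\<bar> \<le> 1 * (2 * sqrt (real n))"
    "\<bar>diag_partial2 s * emp_process (snd_le (1 - s)) n \<omega>\<bar> \<le> 1 * (2 * sqrt (real n))"
    unfolding abs_mult using diag_partial_bounds[of s]
    by (intro mult_mono abs_emp_process_le; simp add: abs_indicators_le)+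
  moreover have "0 \<le> sqrt (real n)" by simp
  ultimately show ?thesis unfolding remainder_def by linarith
qed

sublocale LM: pair_prob_space unit_law M
  by (intro pair_prob_space.intro pair_sigma_finite.intro prob_space_imp_sigma_finite
      prob_space_unit_law prob_space_axioms)

lemma integrable_remainder: "integrable (unit_law \<Otimes>\<^sub>M M) (\<lambda>(s, \<omega>). remainder n s \<omega>)"
  by (rule LM.integrable_const_bound[OF _ remainder_measurable, where B="6 * sqrt (real n)"]) (auto simp: abs_remainder_le_const)

lemma rv_remainder: "random_variable borel (remainder n s)"
  using measurable_Pair2[OF remainder_measurable, of s n] by simp

lemma integrable_remainder_section: "integrable M (remainder n s)"
  by (rule integrable_const_bound[OF _ rv_remainder, where B="6 * sqrt (real n)"]) (auto simp: abs_remainder_le_const)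

section \<open>Convergence of the remainder in mean\<close>

text \<open>The dominating constant for the integral over \<open>s\<close>: 2 from the discreteness
  of ranks, as \<open>n > 0\<close>, and 2 from each process, whose second moment is at most
  1.\<close>

lemma expectation_abs_remainder_le:
  assumes n: "n > 0" and s: "0 < s" "s < 1"
  shows "expectation (\<lambda>\<omega>. \<bar>remainder n s \<omega>\<bar>) \<le> 6"
proof -
  have int: "integrable M (\<lambda>\<omega>. \<bar>emp_process (fst_le s) n \<omega>\<bar>)" "integrable M (\<lambda>\<omega>. \<bar>emp_process (snd_le (1 - s)) n \<omega>\<bar>)"
    by (auto intro!: integrable_abs expectation_abs_emp_process_le(1)[where B=1] simp: abs_indicators_le)
  have le1: "expectation (\<lambda>\<omega>. \<bar>emp_process g n \<omega>\<bar>) \<le> 1"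
    if "g \<in> borel_measurable borel" "\<And>p. \<bar>g p\<bar> \<le> 1" "expectation (\<lambda>\<omega>. (emp_process g n \<omega>)\<^sup>2) \<le> 1" for g
  proof -
    have "expectation (\<lambda>\<omega>. \<bar>emp_process g n \<omega>\<bar>) \<le> sqrt (expectation (\<lambda>\<omega>. (emp_process g n \<omega>)\<^sup>2))"
      by (rule expectation_abs_le_sqrt[OF rv_emp_process emp_process_second_moment(1)]) (use that in auto)
    also have "\<dots> \<le> 1" using that(3) by simp
    finally show ?thesis .
  qed
  have "expectation (\<lambda>\<omega>. \<bar>remainder n s \<omega>\<bar>)
      \<le> expectation (\<lambda>\<omega>. 2 / sqrt (real n) + 2 * \<bar>emp_process (fst_le s) n \<omega>\<bar> + 2 * \<bar>emp_process (snd_le (1 - s)) n \<omega>\<bar>)"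
  proof (rule integral_mono_AE)
    show "AE \<omega> in M. \<bar>remainder n s \<omega>\<bar>
        \<le> 2 / sqrt (real n) + 2 * \<bar>emp_process (fst_le s) n \<omega>\<bar> + 2 * \<bar>emp_process (snd_le (1 - s)) n \<omega>\<bar>"
      using AE_no_ties by eventually_elim (intro abs_remainder_le_emp_process; use n s in auto)
  qed (use int integrable_remainder_section in auto)
  also have "\<dots> = 2 / sqrt (real n) + 2 * expectation (\<lambda>\<omega>. \<bar>emp_process (fst_le s) n \<omega>\<bar>)
      + 2 * expectation (\<lambda>\<omega>. \<bar>emp_process (snd_le (1 - s)) n \<omega>\<bar>)"
    using int by (simp add: prob_space)
  also have "\<dots> \<le> 2 + 2 * 1 + 2 * 1"
    using n by (intro add_mono mult_left_mono le1 expectation_emp_process_indicator_square)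
      (auto simp: abs_indicators_le divide_le_eq)
  finally show ?thesis by simp
qed

text \<open>For fixed \<open>N\<close> the limit superior in \<open>n\<close> is at most
  \<open>12 / N\<close>: 4 from the mesh spacing and 8 from the two second moments that account for
  leaving the mesh. \<open>N\<close> is chosen before \<open>n\<close> grows, so the mesh stays
  fixed in the limit.\<close>

lemma expectation_abs_remainder_tendsto:
  assumes s: "0 < s" "s < 1"
  shows "(\<lambda>n. expectation (\<lambda>\<omega>. \<bar>remainder n s \<omega>\<bar>)) \<longlonglongrightarrow> 0"
proof -
  have bound: "\<forall>\<^sub>F n in sequentially. expectation (\<lambda>\<omega>. \<bar>remainder n s \<omega>\<bar>)
      \<le> 2 / sqrt (real n) + 12 / real N + (\<Sum>(x, y)\<in>mesh N. expectation (local_error n s x y))"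
    if N: "N > 0" for N
  proof -
    have "(\<lambda>n. real N / sqrt (real n)) \<longlonglongrightarrow> 0" by real_asymp
    then have "\<forall>\<^sub>F n in sequentially. real N / sqrt (real n) < min s (1 - s)"
      by (rule order_tendstoD) (use s in simp)
    then show ?thesis
      using eventually_gt_at_top[of 0]
    proof eventually_elim
      fix n assume small: "real N / sqrt (real n) < min s (1 - s)" and n: "(0::nat) < n"
      have int: "integrable M (\<lambda>\<omega>. (emp_process (fst_le s) n \<omega>)\<^sup>2)"
        "integrable M (\<lambda>\<omega>. (emp_process (snd_le (1 - s)) n \<omega>)\<^sup>2)"
        by (intro emp_process_second_moment(1)[where B=1]; simp add: abs_indicators_le)+
      have intL: "integrable M (local_error n s x y)" for x y
        unfolding local_error_def[abs_def] Let_def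
        by (intro Bochner_Integration.integrable_add integrable_abs Bochner_Integration.integrable_diff
            expectation_abs_emp_process_le(1)[where B=1]; simp add: abs_indicators_le)
      have intS: "integrable M (\<lambda>\<omega>. \<Sum>(x, y)\<in>mesh N. local_error n s x y \<omega>)"
        using intL by (intro Bochner_Integration.integrable_sum) auto
      let ?B = "\<lambda>\<omega>. 2 / sqrt (real n) + 4 / real N
          + 4 / real N * ((emp_process (fst_le s) n \<omega>)\<^sup>2 + (emp_process (snd_le (1 - s)) n \<omega>)\<^sup>2)
          + (\<Sum>(x, y)\<in>mesh N. local_error n s x y \<omega>)"
      have "expectation (\<lambda>\<omega>. \<bar>remainder n s \<omega>\<bar>) \<le> expectation ?B"
      proof (rule integral_mono_AE)
        show "AE \<omega> in M. \<bar>remainder n s \<omega>\<bar> \<le> ?B \<omega>"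
          using AE_no_ties
        proof eventually_elim
          fix \<omega> assume "\<forall>n. inj_on (\<lambda>i. X i \<omega>) {1..n} \<and> inj_on (\<lambda>i. Y i \<omega>) {1..n}"
          then show "\<bar>remainder n s \<omega>\<bar> \<le> ?B \<omega>"
            using abs_remainder_le_mesh[OF N n s less_imp_le[OF small], of \<omega>] by simp
        qed
      qed (use int intS integrable_remainder_section in auto)
      also have "\<dots> = 2 / sqrt (real n) + 4 / real N
          + 4 / real N * (expectation (\<lambda>\<omega>. (emp_process (fst_le s) n \<omega>)\<^sup>2)
            + expectation (\<lambda>\<omega>. (emp_process (snd_le (1 - s)) n \<omega>)\<^sup>2))
          + expectation (\<lambda>\<omega>. \<Sum>(x, y)\<in>mesh N. local_error n s x y \<omega>)"
        using int intS by (simp add: prob_space)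
      also have "\<dots> \<le> 2 / sqrt (real n) + 4 / real N + 4 / real N * (1 + 1)
          + expectation (\<lambda>\<omega>. \<Sum>(x, y)\<in>mesh N. local_error n s x y \<omega>)"
        by (intro add_mono mult_left_mono expectation_emp_process_indicator_square order_refl) auto
      also have "expectation (\<lambda>\<omega>. \<Sum>(x, y)\<in>mesh N. local_error n s x y \<omega>)
          = (\<Sum>(x, y)\<in>mesh N. expectation (local_error n s x y))"
        using intL by (subst Bochner_Integration.integral_sum) (auto intro!: sum.cong)
      finally show "expectation (\<lambda>\<omega>. \<bar>remainder n s \<omega>\<bar>)
          \<le> 2 / sqrt (real n) + 12 / real N + (\<Sum>(x, y)\<in>mesh N. expectation (local_error n s x y))"
        by simp
    qed
  qed
  show ?thesis
  proof (rule order_tendstoI)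
    fix a :: real assume "a < 0"
    then show "\<forall>\<^sub>F n in sequentially. a < expectation (\<lambda>\<omega>. \<bar>remainder n s \<omega>\<bar>)"
      by (intro always_eventually allI) (auto intro: less_le_trans)
  next
    fix a :: real assume a: "0 < a"
    obtain N where N: "N > 0" "12 / real N < a"
    proof -
      obtain N :: nat where "12 / a < real N" using reals_Archimedean2 by blast
      moreover have "0 < 12 / a" using a by simp
      ultimately have "0 < real N" by linarith
      with \<open>12 / a < real N\<close> a have "12 / real N < a" by (simp add: field_simps)
      with \<open>0 < real N\<close> show ?thesis using that by simp
    qed
    have "(\<lambda>n. 2 / sqrt (real n)) \<longlonglongrightarrow> 0" by real_asymp
    moreover have "(\<lambda>n. \<Sum>(x, y)\<in>mesh N. expectation (local_error n s x y)) \<longlonglongrightarrow> 0"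
      using tendsto_sum[of "mesh N" "\<lambda>p n. expectation (local_error n s (fst p) (snd p))" "\<lambda>_. 0" sequentially]
        expectation_local_error_tendsto[OF s]
      by (simp add: case_prod_beta')
    ultimately have "(\<lambda>n. 2 / sqrt (real n) + 12 / real N
        + (\<Sum>(x, y)\<in>mesh N. expectation (local_error n s x y))) \<longlonglongrightarrow> 0 + 12 / real N + 0"
      by (intro tendsto_add tendsto_const)
    then have "\<forall>\<^sub>F n in sequentially. 2 / sqrt (real n) + 12 / real N
        + (\<Sum>(x, y)\<in>mesh N. expectation (local_error n s x y)) < a"
      by (rule order_tendstoD) (use N in simp)
    with bound[OF N(1)] show "\<forall>\<^sub>F n in sequentially. expectation (\<lambda>\<omega>. \<bar>remainder n s \<omega>\<bar>) < a"
      by eventually_elim linarith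
  qed
qed

lemma expectation_abs_integral_remainder_tendsto:
  "(\<lambda>n. expectation (\<lambda>\<omega>. \<bar>LINT s|unit_law. remainder n s \<omega>\<bar>)) \<longlonglongrightarrow> 0"
proof (rule Lim_null_comparison)
  have meas: "(\<lambda>s. expectation (\<lambda>\<omega>. \<bar>remainder n s \<omega>\<bar>)) \<in> borel_measurable unit_law" for n
    using remainder_measurable[of n] by (intro borel_measurable_lebesgue_integral) (simp add: case_prod_beta')
  \<comment> \<open>Shifted to \<open>Suc n\<close> because the bound 6 is stated for
    \<open>n > 0\<close>.\<close>
  have "(\<lambda>n. LINT s|unit_law. expectation (\<lambda>\<omega>. \<bar>remainder (Suc n) s \<omega>\<bar>)) \<longlonglongrightarrow> (LINT s|unit_law. 0)"
  proof (rule integral_dominated_convergence[where w="\<lambda>_. 6"])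
    show "AE s in unit_law. (\<lambda>n. expectation (\<lambda>\<omega>. \<bar>remainder (Suc n) s \<omega>\<bar>)) \<longlonglongrightarrow> 0"
      using AE_unit_law
      by eventually_elim (use LIMSEQ_Suc[OF expectation_abs_remainder_tendsto] in auto)
    show "AE s in unit_law. norm (expectation (\<lambda>\<omega>. \<bar>remainder (Suc n) s \<omega>\<bar>)) \<le> 6" for n
      using AE_unit_law by eventually_elim (use expectation_abs_remainder_le in auto)
  qed (use meas in \<open>auto simp: LM.M1.integrable_const\<close>)
  then show "(\<lambda>n. LINT s|unit_law. expectation (\<lambda>\<omega>. \<bar>remainder n s \<omega>\<bar>)) \<longlonglongrightarrow> 0"
    by (subst filterlim_sequentially_Suc[symmetric]) simp
  show "\<forall>\<^sub>F n in sequentially. norm (expectation (\<lambda>\<omega>. \<bar>LINT s|unit_law. remainder n s \<omega>\<bar>))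
      \<le> (LINT s|unit_law. expectation (\<lambda>\<omega>. \<bar>remainder n s \<omega>\<bar>))"
  proof (intro always_eventually allI)
    fix n
    have int: "integrable (unit_law \<Otimes>\<^sub>M M) (\<lambda>(s, \<omega>). \<bar>remainder n s \<omega>\<bar>)"
      using integrable_abs[OF integrable_remainder[of n]] by (simp add: case_prod_beta')
    have "expectation (\<lambda>\<omega>. \<bar>LINT s|unit_law. remainder n s \<omega>\<bar>) \<le> expectation (\<lambda>\<omega>. LINT s|unit_law. \<bar>remainder n s \<omega>\<bar>)"
      by (intro integral_mono integrable_abs LM.integrable_snd integrable_remainder int integral_abs_bound)
    also have "\<dots> = (LINT s|unit_law. expectation (\<lambda>\<omega>. \<bar>remainder n s \<omega>\<bar>))"
      by (rule LM.Fubini_integral[OF int])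
    finally show "norm (expectation (\<lambda>\<omega>. \<bar>LINT s|unit_law. remainder n s \<omega>\<bar>))
      \<le> (LINT s|unit_law. expectation (\<lambda>\<omega>. \<bar>remainder n s \<omega>\<bar>))" by simp
  qed
qed

subsection \<open>The influence function\<close>

text \<open>One observation's share in the linearized empirical copula at \<open>(s, 1 - s)\<close>.
  The marginal indicators are centred, so for \<open>s\<close> in the unit interval its mean is
  \<open>C s (1 - s)\<close>.\<close>

definition influence_kernel :: "real \<Rightarrow> real \<times> real \<Rightarrow> real" where
  "influence_kernel s p = both_le s (1 - s) p - diag_partial1 s * (fst_le s p - s) - diag_partial2 s * (snd_le (1 - s) p - (1 - s))"

definition influence :: "real \<times> real \<Rightarrow> real" where
  "influence p = (LINT s|unit_law. influence_kernel s p)"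

text \<open>Equal to \<open>(W_footrule C + 1) / 6\<close> by \<open>W_footrule_eq\<close>: the
  target of the average of positive parts inside the estimator.\<close>

definition theta :: real where
  "theta = (LINT p|Q. max (1 - fst p - snd p) 0)"

sublocale LQ: pair_prob_space unit_law Q
  by (intro pair_prob_space.intro pair_sigma_finite.intro prob_space_imp_sigma_finite
      prob_space_unit_law Q.prob_space_axioms)

lemma sets_LQ: "sets (unit_law \<Otimes>\<^sub>M Q) = sets (borel \<Otimes>\<^sub>M (borel \<Otimes>\<^sub>M borel))"
  by (rule sets_pair_measure_cong[OF sets_unit_law]) (simp only: sets_Q borel_prod)

lemma indicators_measurable_pair:
  "(\<lambda>(s, p). fst_le s p) \<in> borel_measurable (unit_law \<Otimes>\<^sub>M Q)"
  "(\<lambda>(s, p). snd_le s p) \<in> borel_measurable (unit_law \<Otimes>\<^sub>M Q)"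
  "(\<lambda>(s, p). both_le s (1 - s) p) \<in> borel_measurable (unit_law \<Otimes>\<^sub>M Q)"
  "(\<lambda>(s, p). influence_kernel s p) \<in> borel_measurable (unit_law \<Otimes>\<^sub>M Q)"
  unfolding influence_kernel_def fst_le_def snd_le_def both_le_def measurable_cong_sets[OF sets_LQ refl]
  by measurable

text \<open>Differences such as \<open>fst_le s p - s\<close> are unbounded in \<open>s\<close>, but
  their weights vanish off the open unit interval; inside it each of the three terms is at most 1 in
  absolute value.\<close>

lemma abs_influence_kernel_le: "\<bar>influence_kernel s p\<bar> \<le> 3"
proof -
  have *: "\<bar>c * (e - r)\<bar> \<le> 1"
    if "0 \<le> c" "c \<le> 1" "0 < s \<and> s < 1 \<Longrightarrow> 0 \<le> r \<and> r \<le> 1" "\<not> (0 < s \<and> s < 1) \<Longrightarrow> c = 0" "0 \<le> e" "e \<le> 1"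
    for c e r :: real
  proof (cases "0 < s \<and> s < 1")
    case True
    then have "\<bar>e - r\<bar> \<le> 1" using that(3,5,6) by (auto simp: abs_le_iff)
    then have "\<bar>c\<bar> * \<bar>e - r\<bar> \<le> 1 * 1" using that(1,2) by (intro mult_mono) auto
    then show ?thesis by (simp add: abs_mult)
  qed (use that(4) in simp)
  have "\<bar>diag_partial1 s * (fst_le s p - s)\<bar> \<le> 1" "\<bar>diag_partial2 s * (snd_le (1 - s) p - (1 - s))\<bar> \<le> 1"
    using diag_partial_bounds[of s] by (intro *; auto simp: diag_partial1_def diag_partial2_def fst_le_def snd_le_def)+
  moreover have "\<bar>both_le s (1 - s) p\<bar> \<le> 1" by (rule abs_indicators_le)
  ultimately show ?thesis unfolding influence_kernel_def by linarith
qed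

lemma integrable_LQ:
  assumes "(\<lambda>(s, p). f s p) \<in> borel_measurable (unit_law \<Otimes>\<^sub>M Q)" "\<And>s p. \<bar>f s p\<bar> \<le> (B :: real)"
  shows "integrable (unit_law \<Otimes>\<^sub>M Q) (\<lambda>(s, p). f s p)"
  using assms by (intro LQ.integrable_const_bound[where B=B]) (auto simp: case_prod_beta')

lemma LQ_swap:
  assumes "(\<lambda>(s, p). f s p) \<in> borel_measurable (unit_law \<Otimes>\<^sub>M Q)" "\<And>s p. \<bar>f s p\<bar> \<le> (B :: real)"
  shows "(LINT p|Q. LINT s|unit_law. f s p) = (LINT s|unit_law. LINT p|Q. f s p)"
  by (rule LQ.Fubini_integral[OF integrable_LQ[OF assms]])

lemma integrable_unit_law:
  assumes "f \<in> borel_measurable borel" "\<And>s. s \<in> {0<..<1} \<Longrightarrow> \<bar>f s\<bar> \<le> (B :: real)"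
  shows "integrable unit_law f"
proof (rule LM.M1.integrable_const_bound[where B=B])
  show "AE s in unit_law. norm (f s) \<le> B"
    using AE_unit_law by eventually_elim (use assms(2) in simp)
qed (use assms(1) in \<open>simp add: measurable_cong_sets[OF sets_unit_law refl]\<close>)

lemma indicators_section_measurable:
  "(\<lambda>s. fst_le s p) \<in> borel_measurable borel" "(\<lambda>s. snd_le (1 - s) p) \<in> borel_measurable borel"
  "(\<lambda>s. both_le s (1 - s) p) \<in> borel_measurable borel" "(\<lambda>s. influence_kernel s p) \<in> borel_measurable borel"
proof -
  show 1: "(\<lambda>s. fst_le s p) \<in> borel_measurable borel" "(\<lambda>s. snd_le (1 - s) p) \<in> borel_measurable borel"
    "(\<lambda>s. both_le s (1 - s) p) \<in> borel_measurable borel"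
    unfolding fst_le_def snd_le_def both_le_def by measurable
  note 1 [measurable]
  show "(\<lambda>s. influence_kernel s p) \<in> borel_measurable borel" unfolding influence_kernel_def by measurable
qed

lemma influence_measurable: "influence \<in> borel_measurable borel"
proof -
  have "(\<lambda>(p, s). influence_kernel s p) \<in> borel_measurable (Q \<Otimes>\<^sub>M unit_law)"
    using measurable_compose[OF measurable_pair_swap' indicators_measurable_pair(4)]
    by (simp add: case_prod_beta')
  from LM.M1.borel_measurable_lebesgue_integral[OF this]
  show ?thesis by (simp add: influence_def[abs_def] measurable_cong_sets[OF sets_Q refl])
qed

lemma integrable_influence_kernel: "integrable unit_law (\<lambda>s. influence_kernel s p)"
  by (rule integrable_unit_law[where B=3]) (simp_all add: indicators_section_measurable abs_influence_kernel_le)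

lemma abs_influence_le: "\<bar>influence p\<bar> \<le> 3"
proof -
  have "\<bar>influence p\<bar> \<le> (LINT s|unit_law. \<bar>influence_kernel s p\<bar>)"
    unfolding influence_def by (rule integral_abs_bound)
  also have "\<dots> \<le> (LINT s|unit_law. 3)"
    using integrable_influence_kernel by (intro integral_mono) (auto simp: abs_influence_kernel_le)
  also have "\<dots> = 3" using LM.M1.prob_space by simp
  finally show ?thesis .
qed

lemma integral_both_le_diagonal:
  assumes "p \<in> {0..1} \<times> {0..1}"
  shows "(LINT s|unit_law. both_le s (1 - s) p) = max (1 - fst p - snd p) 0"
proof -
  have "both_le s (1 - s) p = of_bool (fst p \<le> s \<and> s \<le> 1 - snd p)" for s
    by (auto simp: both_le_def)
  then show ?thesis
    using assms integral_unit_law_Icc[of "fst p" "1 - snd p"] by (auto simp: algebra_simps)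
qed

text \<open>The integrals are exchanged twice, since the centred marginal indicators have mean 0 at
  a fixed level, while the rectangle indicator integrates to the positive part at a fixed
  point.\<close>

lemma integral_influence: "(LINT p|Q. influence p) = theta"
proof -
  have "(LINT p|Q. influence p) = (LINT s|unit_law. LINT p|Q. influence_kernel s p)"
    unfolding influence_def by (rule LQ_swap[OF indicators_measurable_pair(4) abs_influence_kernel_le])
  also have "\<dots> = (LINT s|unit_law. LINT p|Q. both_le s (1 - s) p)"
  proof (rule integral_cong_AE)
    show "AE s in unit_law. (LINT p|Q. influence_kernel s p) = (LINT p|Q. both_le s (1 - s) p)"
      using AE_unit_law
      by eventually_elim (simp add: influence_kernel_def integral_fst_le integral_snd_le)
  qed (use indicators_measurable_pair(3,4) in \<open>auto intro!: Q.borel_measurable_lebesgue_integral\<close>)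
  also have "\<dots> = (LINT p|Q. LINT s|unit_law. both_le s (1 - s) p)"
    by (rule LQ_swap[OF indicators_measurable_pair(3) abs_indicators_le(3), symmetric])
  also have "\<dots> = theta"
    unfolding theta_def
  proof (rule integral_cong_AE)
    have "(\<lambda>(p, s). both_le s (1 - s) p) \<in> borel_measurable (Q \<Otimes>\<^sub>M unit_law)"
      using measurable_compose[OF measurable_pair_swap' indicators_measurable_pair(3)]
      by (simp add: case_prod_beta')
    from LM.M1.borel_measurable_lebesgue_integral[OF this]
    show "(\<lambda>p. LINT s|unit_law. both_le s (1 - s) p) \<in> borel_measurable Q" .
    show "(\<lambda>p. max (1 - fst p - snd p) 0) \<in> borel_measurable Q"
      unfolding measurable_cong_sets[OF sets_Q refl] borel_prod[symmetric] by measurable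
  qed (use AE_Q_unit_square in \<open>auto elim!: eventually_mono simp: integral_both_le_diagonal\<close>)
  finally show ?thesis .
qed

text \<open>With \<open>a = 1 - u - v\<close>, the identity
  \<open>\<bar>a\<bar> = 2 * max a 0 - a\<close> reduces the claim to \<open>a\<close> having mean
  0, that is, to both margins having mean \<open>1 / 2\<close>.\<close>

lemma W_footrule_eq: "W_footrule C = 6 * theta - 1"
proof -
  have meas [measurable]: "fst \<in> borel_measurable Q" "snd \<in> borel_measurable Q"
    unfolding measurable_cong_sets[OF sets_Q refl] borel_prod[symmetric] by measurable
  have meas': "(\<lambda>p. \<bar>1 - fst p - snd p\<bar>) \<in> borel_measurable (borel :: (real \<times> real) measure)"
    unfolding borel_prod[symmetric] by measurable
  have bnd: "AE p in Q. 0 \<le> fst p \<and> fst p \<le> 1 \<and> 0 \<le> snd p \<and> snd p \<le> 1"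
    using AE_Q_unit_square by eventually_elim auto
  have "AE p in Q. norm (fst p) \<le> 1" "AE p in Q. norm (snd p) \<le> 1"
    "AE p in Q. norm (max (1 - fst p - snd p) 0) \<le> 1"
    using bnd by (eventually_elim; auto)+
  then have int: "integrable Q fst" "integrable Q snd"
    and intm: "integrable Q (\<lambda>p. max (1 - fst p - snd p) 0)"
    by (auto intro!: Q.integrable_const_bound[where B=1])
  have half: "(LINT s|unit_law. s) = 1 / 2"
  proof -
    have "(LINT s|unit_law. s) = (LINT s|lborel. indicator {0<..<1} s * s)"
      by (rule integral_unit_law) simp
    also have "\<dots> = (LINT s|lborel. s ^ 1 * indicator {0..1} s)"
    proof (rule integral_cong_AE)
      show "AE s in lborel. indicator {0<..<1} s * s = s ^ 1 * indicator {0..1::real} s"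
        using AE_lborel_singleton[of "1::real"] by eventually_elim (auto simp: indicator_def)
    qed auto
    also have "\<dots> = 1 / 2" by (subst integral_power) auto
    finally show ?thesis .
  qed
  have strip: "(LINT s|unit_law. of_bool (a \<le> s)) = 1 - a" if "0 \<le> a" "a \<le> 1" for a :: real
  proof -
    have "(LINT s|unit_law. of_bool (a \<le> s)) = (LINT s|unit_law. of_bool (a \<le> s \<and> s \<le> 1) :: real)"
    proof (rule integral_cong_AE)
      show "AE s in unit_law. of_bool (a \<le> s) = (of_bool (a \<le> s \<and> s \<le> 1) :: real)"
        using AE_unit_law by eventually_elim simp
    qed auto
    then show ?thesis using integral_unit_law_Icc[of a 1] that by simp
  qed
  \<comment> \<open>The mean of a margin is read off its distribution function:
    \<open>1 - f p\<close> is the integral over \<open>s\<close> of the indicator of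
    \<open>f p \<le> s\<close>.\<close>
  have E: "(LINT p|Q. 1 - f p) = 1 / 2"
    if f: "f \<in> borel_measurable Q" "AE p in Q. 0 \<le> f p \<and> f p \<le> 1"
      and g: "(\<lambda>(s, p). g s p) \<in> borel_measurable (unit_law \<Otimes>\<^sub>M Q)" "\<And>s p. g s p = of_bool (f p \<le> s)"
      and I: "\<And>s. 0 \<le> s \<Longrightarrow> s \<le> 1 \<Longrightarrow> (LINT p|Q. g s p) = s"
    for f :: "real \<times> real \<Rightarrow> real" and g :: "real \<Rightarrow> real \<times> real \<Rightarrow> real"
  proof -
    have "(\<lambda>(p, s). g s p) \<in> borel_measurable (Q \<Otimes>\<^sub>M unit_law)"
      using measurable_compose[OF measurable_pair_swap' g(1)] by (simp add: case_prod_beta')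
    from LM.M1.borel_measurable_lebesgue_integral[OF this]
    have "(LINT p|Q. 1 - f p) = (LINT p|Q. LINT s|unit_law. g s p)"
    proof (intro integral_cong_AE)
      show "AE p in Q. 1 - f p = (LINT s|unit_law. g s p)"
        using f(2) by eventually_elim (simp add: strip g(2))
    qed (use f(1) in auto)
    also have "\<dots> = (LINT s|unit_law. LINT p|Q. g s p)"
      by (rule LQ_swap[OF g(1), of 1]) (simp add: g(2))
    also have "\<dots> = (LINT s|unit_law. s)"
    proof (intro integral_cong_AE)
      show "AE s in unit_law. (LINT p|Q. g s p) = s"
        using AE_unit_law by eventually_elim (simp add: I)
    qed (use Q.borel_measurable_lebesgue_integral[OF g(1)] in auto)
    finally show ?thesis using half by simp
  qed
  have "(LINT p|Q. 1 - fst p) = 1 / 2"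
  proof (rule E[OF _ _ indicators_measurable_pair(1)])
    show "AE p in Q. 0 \<le> fst p \<and> fst p \<le> 1" using bnd by eventually_elim simp
  qed (simp_all add: integral_fst_le, simp add: fst_le_def)
  moreover have "(LINT p|Q. 1 - snd p) = 1 / 2"
  proof (rule E[OF _ _ indicators_measurable_pair(2)])
    show "AE p in Q. 0 \<le> snd p \<and> snd p \<le> 1" using bnd by eventually_elim simp
  qed (simp_all add: integral_snd_le, simp add: snd_le_def)
  ultimately have "(LINT p|Q. fst p) = 1 / 2" "(LINT p|Q. snd p) = 1 / 2"
    using int by simp_all
  moreover have "\<bar>1 - u - v\<bar> = 2 * max (1 - u - v) 0 - (1 - u - v)" for u v :: real
    by (simp add: max_def)
  ultimately have "(LINT p|Q. \<bar>1 - fst p - snd p\<bar>) = 2 * theta"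
    using int intm by (simp add: theta_def)
  moreover have "(LINT p|copula_measure C. (case p of (u, v) \<Rightarrow> \<bar>1 - u - v\<bar>)) = (LINT p|Q. \<bar>1 - fst p - snd p\<bar>)"
    by (rule integral_copula_measure[OF meas']) auto
  ultimately show ?thesis by (simp add: W_footrule_def)
qed

text \<open>Measurability is asked of the integrand cut off to the open unit interval, the form in
  which it is known for the partial derivatives.\<close>

lemma interval_integral_eq_unit_law:
  fixes f :: "real \<Rightarrow> real"
  assumes ab: "0 \<le> a" "a \<le> b" "b \<le> 1" and f: "(\<lambda>s. indicator {0<..<1} s * f s) \<in> borel_measurable borel"
  shows "(LBINT s=ereal a..ereal b. f s)
    = (LINT s|unit_law. indicator {0<..<1} s * f s * of_bool (a \<le> s \<and> s \<le> b))"
proof -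
  have [measurable]: "(\<lambda>s. indicator {0<..<1} s * f s * of_bool (a \<le> s \<and> s \<le> b)) \<in> borel_measurable borel"
    by (rule borel_measurable_times[OF f]) measurable
  have "(LBINT s=ereal a..ereal b. f s) = (LINT s|lborel. indicator {a<..<b} s * f s)"
    using ab by (simp add: interval_lebesgue_integral_def set_lebesgue_integral_def)
  also have "\<dots> = (LINT s|lborel. indicator {0<..<1} s * (indicator {0<..<1} s * f s * of_bool (a \<le> s \<and> s \<le> b)))"
  proof (rule integral_cong_AE)
    have eq: "(\<lambda>s. indicator {a<..<b} s * f s) = (\<lambda>s. indicator {a<..<b} s * (indicator {0<..<1} s * f s))"
      using ab by (auto simp: indicator_def fun_eq_iff)
    show "(\<lambda>s. indicator {a<..<b} s * f s) \<in> borel_measurable lborel"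
      unfolding eq measurable_lborel2 by (intro borel_measurable_times f) measurable
    have "AE s in lborel. s \<noteq> a \<and> s \<noteq> b"
      using AE_lborel_singleton[of a] AE_lborel_singleton[of b] by eventually_elim auto
    then show "AE s in lborel. indicator {a<..<b} s * f s
        = indicator {0<..<1} s * (indicator {0<..<1} s * f s * of_bool (a \<le> s \<and> s \<le> b))"
      by eventually_elim (use ab in \<open>auto simp: indicator_def\<close>)
  qed measurable
  also have "\<dots> = (LINT s|unit_law. indicator {0<..<1} s * f s * of_bool (a \<le> s \<and> s \<le> b))"
    by (rule integral_unit_law[symmetric]) measurable
  finally show ?thesis .
qed

text \<open>
  The additive constant, due to centring the indicators in the kernel, does not affect the variance.
\<close>

lemma influence_eq_j_fun:
  assumes p: "p \<in> {0..1} \<times> {0..1}"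
  shows "influence p = j_fun C (fst p) (snd p) + (LINT s|unit_law. diag_partial1 s * s + diag_partial2 s * (1 - s))"
proof -
  obtain u v where uv: "p = (u, v)" "0 \<le> u" "u \<le> 1" "0 \<le> v" "v \<le> 1" using p by auto
  note indicators_section_measurable[measurable]
  have c: "\<bar>diag_partial1 s * x\<bar> \<le> 1" "\<bar>diag_partial2 s * x\<bar> \<le> 1" if "\<bar>x\<bar> \<le> 1" for s x
    unfolding abs_mult using that diag_partial_bounds[of s] by (auto intro: mult_le_one)
  have intb: "integrable unit_law (\<lambda>s. both_le s (1 - s) p)"
    by (rule integrable_unit_law[where B=1]) (auto simp: abs_indicators_le)
  have int1: "integrable unit_law (\<lambda>s. diag_partial1 s * fst_le s p)" "integrable unit_law (\<lambda>s. diag_partial2 s * snd_le (1 - s) p)"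
    by (rule integrable_unit_law[where B=1]; auto intro!: c simp: abs_indicators_le)+
  have int2: "integrable unit_law (\<lambda>s. diag_partial1 s * s)" "integrable unit_law (\<lambda>s. diag_partial2 s * (1 - s))"
    by (rule integrable_unit_law[where B=1]; auto intro!: c)+
  have "influence p = (LINT s|unit_law. both_le s (1 - s) p - diag_partial1 s * fst_le s p - diag_partial2 s * snd_le (1 - s) p
      + (diag_partial1 s * s + diag_partial2 s * (1 - s)))"
    unfolding influence_def influence_kernel_def by (simp add: algebra_simps)
  also have "\<dots> = (LINT s|unit_law. both_le s (1 - s) p) - (LINT s|unit_law. diag_partial1 s * fst_le s p)
      - (LINT s|unit_law. diag_partial2 s * snd_le (1 - s) p) + (LINT s|unit_law. diag_partial1 s * s + diag_partial2 s * (1 - s))"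
    using intb int1 int2 by simp
  also have "(LINT s|unit_law. both_le s (1 - s) p) = max (1 - u - v) 0"
    using integral_both_le_diagonal[OF p] uv by simp
  also have "(LINT s|unit_law. diag_partial1 s * fst_le s p) = (LBINT s=ereal u..ereal 1. partial1 C s (1 - s))"
  proof -
    have "(LBINT s=ereal u..ereal 1. partial1 C s (1 - s))
        = (LINT s|unit_law. indicator {0<..<1} s * partial1 C s (1 - s) * of_bool (u \<le> s \<and> s \<le> 1))"
      using uv diag_partial_measurable(1) by (intro interval_integral_eq_unit_law) (simp_all add: diag_partial1_def[abs_def])
    also have "\<dots> = (LINT s|unit_law. diag_partial1 s * fst_le s p)"
      by (intro Bochner_Integration.integral_cong) (auto simp: diag_partial1_def fst_le_def uv indicator_def)
    finally show ?thesis by simp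
  qed
  \<comment> \<open>The condition \<open>v \<le> 1 - s\<close> reads \<open>s \<le> 1 - v\<close>,
    which explains the upper limit of the second integral in \<open>j_fun\<close>.\<close>
  also have "(LINT s|unit_law. diag_partial2 s * snd_le (1 - s) p) = (LBINT s=ereal 0..ereal (1 - v). partial2 C s (1 - s))"
  proof -
    have "(LBINT s=ereal 0..ereal (1 - v). partial2 C s (1 - s))
        = (LINT s|unit_law. indicator {0<..<1} s * partial2 C s (1 - s) * of_bool (0 \<le> s \<and> s \<le> 1 - v))"
      using uv diag_partial_measurable(2) by (intro interval_integral_eq_unit_law) (simp_all add: diag_partial2_def[abs_def])
    also have "\<dots> = (LINT s|unit_law. diag_partial2 s * snd_le (1 - s) p)"
      by (intro Bochner_Integration.integral_cong) (auto simp: diag_partial2_def snd_le_def uv indicator_def)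
    finally show ?thesis by simp
  qed
  finally show ?thesis by (simp add: j_fun_def uv)
qed

text \<open>As the integral of a square the variance is visibly nonnegative, which the normal law
  requires, and it matches the second moment of the centred i.i.d. summands.\<close>

lemma W_footrule_avar_eq: "W_footrule_avar C = 36 * (LINT p|Q. (influence p - theta)\<^sup>2)"
proof -
  define k where "k = (LINT s|unit_law. diag_partial1 s * s + diag_partial2 s * (1 - s))"
  have int: "integrable Q influence" by (rule integrable_Q[OF influence_measurable abs_influence_le])
  note influence_measurable [measurable]
  have mean: "(LINT p|copula_measure C. (case p of (u, v) \<Rightarrow> j_fun C u v)) = theta - k"
  proof -
    have "(LINT p|copula_measure C. (case p of (u, v) \<Rightarrow> j_fun C u v)) = (LINT p|Q. influence p - k)"
      by (rule integral_copula_measure) (auto simp: influence_eq_j_fun k_def)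
    then show ?thesis using int by (simp add: integral_influence)
  qed
  have "(LINT p|copula_measure C. ((case p of (u, v) \<Rightarrow> j_fun C u v) - (theta - k))\<^sup>2) = (LINT p|Q. (influence p - theta)\<^sup>2)"
    by (rule integral_copula_measure) (auto simp: influence_eq_j_fun k_def algebra_simps)
  then show ?thesis unfolding W_footrule_avar_def mean by simp
qed

section \<open>Decomposition of the estimator and the limit law\<close>

text \<open>At each level in the open interval the remainder is a normalized sum of rank indicators
  minus kernels, and integrating indicators of intervals gives positive parts. The identity is
  exact, so all approximation is confined to the remainder.\<close>

lemma integral_remainder_eq:
  assumes \<omega>: "\<omega> \<in> space M"
  shows "(LINT s|unit_law. remainder n s \<omega>)
    = sqrt (real n) * ((\<Sum>i=1..n. max (1 - pseudo_obs (\<lambda>i. X i \<omega>) n i - pseudo_obs (\<lambda>i. Y i \<omega>) n i) 0) / real n - theta)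
      - (\<Sum>i=1..n. influence (P i \<omega>) - theta) / sqrt (real n)"
proof -
  define a where "a i = pseudo_obs (\<lambda>i. X i \<omega>) n i" for i
  define b where "b i = pseudo_obs (\<lambda>i. Y i \<omega>) n i" for i
  have ab: "0 \<le> a i" "0 \<le> b i" for i by (simp_all add: a_def b_def pseudo_obs_def)
  \<comment> \<open>For \<open>n = 0\<close> both sides are 0, by division by zero on the
    right.\<close>
  have r: "sqrt (real n) * (z / real n) = z / sqrt (real n)" for z
    by (cases "n = 0") (simp_all add: field_simps)
  have remainder: "remainder n s \<omega> = (\<Sum>i=1..n. of_bool (a i \<le> s \<and> s \<le> 1 - b i) - influence_kernel s (P i \<omega>)) / sqrt (real n)"
    if s: "0 < s" "s < 1" for s
  proof -
    have "remainder n s \<omega> = ((\<Sum>i=1..n. of_bool (a i \<le> s \<and> b i \<le> 1 - s)) - (\<Sum>i=1..n. both_le s (1 - s) (P i \<omega>))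
        + diag_partial1 s * (\<Sum>i=1..n. fst_le s (P i \<omega>) - s) + diag_partial2 s * (\<Sum>i=1..n. snd_le (1 - s) (P i \<omega>) - (1 - s)))
        / sqrt (real n)"
      unfolding remainder_def card_low_eq_sum emp_process_def a_def b_def right_diff_distrib r using s
      by (simp add: integral_fst_le integral_snd_le add_divide_distrib diff_divide_distrib)
    also have "\<dots> = (\<Sum>i=1..n. of_bool (a i \<le> s \<and> b i \<le> 1 - s) - influence_kernel s (P i \<omega>)) / sqrt (real n)"
      by (simp add: influence_kernel_def sum_subtractf sum.distrib sum_distrib_left algebra_simps)
    also have "(\<lambda>i. b i \<le> 1 - s) = (\<lambda>i. s \<le> 1 - b i)" by auto
    finally show ?thesis .
  qed
  have meas: "(\<lambda>s. remainder n s \<omega>) \<in> borel_measurable unit_law"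
    using measurable_Pair1[OF remainder_measurable \<omega>, of n] by simp
  have intb: "integrable unit_law (\<lambda>s. of_bool (a i \<le> s \<and> s \<le> 1 - b i) :: real)" for i
    by (rule integrable_unit_law[where B=1]) auto
  have int: "integrable unit_law (\<lambda>s. of_bool (a i \<le> s \<and> s \<le> 1 - b i) - influence_kernel s (P i \<omega>))" for i
    by (intro Bochner_Integration.integrable_diff intb integrable_influence_kernel)
  have "(LINT s|unit_law. remainder n s \<omega>)
      = (LINT s|unit_law. (\<Sum>i=1..n. of_bool (a i \<le> s \<and> s \<le> 1 - b i) - influence_kernel s (P i \<omega>)) / sqrt (real n))"
  proof (rule integral_cong_AE)
    show "AE s in unit_law. remainder n s \<omega>
        = (\<Sum>i=1..n. of_bool (a i \<le> s \<and> s \<le> 1 - b i) - influence_kernel s (P i \<omega>)) / sqrt (real n)"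
      using AE_unit_law by eventually_elim (rule remainder; simp)
    show "(\<lambda>s. (\<Sum>i=1..n. of_bool (a i \<le> s \<and> s \<le> 1 - b i) - influence_kernel s (P i \<omega>)) / sqrt (real n))
        \<in> borel_measurable unit_law"
      using int by (intro borel_measurable_divide borel_measurable_sum) auto
  qed (rule meas)
  also have "\<dots> = (\<Sum>i=1..n. (LINT s|unit_law. of_bool (a i \<le> s \<and> s \<le> 1 - b i) - influence_kernel s (P i \<omega>))) / sqrt (real n)"
    using int by simp
  also have "\<dots> = (\<Sum>i=1..n. max (1 - a i - b i) 0 - influence (P i \<omega>)) / sqrt (real n)"
  proof -
    have "(LINT s|unit_law. of_bool (a i \<le> s \<and> s \<le> 1 - b i) - influence_kernel s (P i \<omega>))
        = max (1 - a i - b i) 0 - influence (P i \<omega>)" for i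
    proof -
      have "(LINT s|unit_law. of_bool (a i \<le> s \<and> s \<le> 1 - b i) - influence_kernel s (P i \<omega>))
          = (LINT s|unit_law. of_bool (a i \<le> s \<and> s \<le> 1 - b i)) - influence (P i \<omega>)"
        unfolding influence_def by (intro Bochner_Integration.integral_diff intb integrable_influence_kernel)
      \<comment> \<open>Pseudo-observations are nonnegative, so the interval from \<open>a i\<close>
        to \<open>1 - b i\<close> is empty or lies in the unit interval.\<close>
      also have "(LINT s|unit_law. of_bool (a i \<le> s \<and> s \<le> 1 - b i)) = max (1 - b i - a i) 0"
        using ab by (intro integral_unit_law_Icc) simp_all
      also have "1 - b i - a i = 1 - a i - b i" by simp
      finally show ?thesis .
    qed
    then show ?thesis by simp
  qed
  also have "\<dots> = (\<Sum>i=1..n. max (1 - a i - b i) 0 - theta) / sqrt (real n) - (\<Sum>i=1..n. influence (P i \<omega>) - theta) / sqrt (real n)"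
    by (simp add: sum_subtractf diff_divide_distrib)
  also have "(\<Sum>i=1..n. max (1 - a i - b i) 0 - theta) / sqrt (real n)
      = sqrt (real n) * ((\<Sum>i=1..n. max (1 - a i - b i) 0) / real n - theta)"
    unfolding right_diff_distrib r
    by (simp add: sum_subtractf diff_divide_distrib real_div_sqrt flip: times_divide_eq_left)
  finally show ?thesis by (simp add: a_def b_def)
qed

text \<open>The factor 6 of the estimator matches that of \<open>W_footrule_eq\<close>, and the
  constants \<open>- 1\<close> cancel. The sum is renumbered from 0 for the central limit
  theorem.\<close>

lemma footrule_est_decomposition:
  assumes "\<omega> \<in> space M"
  shows "sqrt (real n) * (W_footrule_est (\<lambda>i. X i \<omega>) (\<lambda>i. Y i \<omega>) n - W_footrule C)
    = (\<Sum>i<n. 6 * (influence (P (Suc i) \<omega>) - theta)) / sqrt (real n) + 6 * (LINT s|unit_law. remainder n s \<omega>)"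
proof -
  have "(\<Sum>i<n. 6 * (influence (P (Suc i) \<omega>) - theta)) = 6 * (\<Sum>i=1..n. influence (P i \<omega>) - theta)"
    by (simp add: sum_distrib_left sum.atLeast1_atMost_eq)
  then show ?thesis
    unfolding integral_remainder_eq[OF assms] W_footrule_eq W_footrule_est_def
    by (simp add: algebra_simps)
qed

lemma asymptotic_normality:
  "weak_conv_m
     (\<lambda>n. distr M borel
        (\<lambda>\<omega>. sqrt (real n) * (W_footrule_est (\<lambda>i. X i \<omega>) (\<lambda>i. Y i \<omega>) n - W_footrule C)))
     (normal_law 0 (W_footrule_avar C))"
proof -
  define Z where "Z i \<omega> = 6 * (influence (P (Suc i) \<omega>) - theta)" for i \<omega>
  define A where "A n \<omega> = (\<Sum>i<n. Z i \<omega>) / sqrt (real n)" for n \<omega>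
  define B where "B n \<omega> = A n \<omega> + 6 * (LINT s|unit_law. remainder n s \<omega>)" for n \<omega>
  note influence_measurable [measurable]
  have intjj: "integrable Q influence" by (rule integrable_Q[OF influence_measurable abs_influence_le])
  have rvZ [measurable]: "random_variable borel (Z i)" for i
    unfolding Z_def by (intro borel_measurable_times borel_measurable_diff borel_measurable_const
        measurable_compose[OF rv_P influence_measurable]) simp
  have bounded: "\<bar>Z i \<omega>\<bar> \<le> 6 * (3 + \<bar>theta\<bar>)" for i \<omega>
    unfolding Z_def abs_mult using abs_influence_le[of "P (Suc i) \<omega>"] by (intro mult_mono) auto
  have indep: "indep_vars (\<lambda>_. borel) Z UNIV"
  proof -
    have "indep_vars (\<lambda>_. borel) (\<lambda>i. P (Suc i)) UNIV"
    proof -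
      have "range Suc = {1..}" by (auto simp: image_iff Suc_le_eq gr0_conv_Suc)
      then show ?thesis using indep_vars_reindex[of Suc UNIV "\<lambda>_. borel" P] indep_P by simp
    qed
    then show ?thesis
      unfolding Z_def by (rule indep_vars_compose2[where Y="\<lambda>_ p. 6 * (influence p - theta)"]) simp
  qed
  have conv: "weak_conv_m (\<lambda>n. distr M borel (A n)) (normal_law 0 (W_footrule_avar C))"
    unfolding A_def[abs_def]
  proof (rule central_limit_normal_law[OF indep])
    show "expectation (Z i) = 0" for i
    proof -
      have "expectation (Z i) = (LINT p|Q. 6 * (influence p - theta))"
        unfolding Z_def by (rule expectation_P) auto
      then show ?thesis using intjj by (simp add: integral_influence)
    qed
    show "expectation (\<lambda>\<omega>. (Z i \<omega>)\<^sup>2) = W_footrule_avar C" for i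
    proof -
      have "expectation (\<lambda>\<omega>. (Z i \<omega>)\<^sup>2) = (LINT p|Q. (6 * (influence p - theta))\<^sup>2)"
        unfolding Z_def by (rule expectation_P) auto
      then show ?thesis unfolding W_footrule_avar_eq power_mult_distrib by simp
    qed
    show "integrable M (\<lambda>\<omega>. (Z i \<omega>)\<^sup>2)" for i
    proof (rule integrable_const_bound[where B="(6 * (3 + \<bar>theta\<bar>))\<^sup>2"])
      have "(Z i \<omega>)\<^sup>2 \<le> (6 * (3 + \<bar>theta\<bar>))\<^sup>2" for \<omega>
        using power_mono[OF bounded[of i \<omega>], where n=2] by simp
      then show "AE \<omega> in M. norm ((Z i \<omega>)\<^sup>2) \<le> (6 * (3 + \<bar>theta\<bar>))\<^sup>2" by simp
    qed measurable
    show "distr M borel (Z i) = distr Q borel (\<lambda>p. 6 * (influence p - theta))" for i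
    proof -
      have "distr (distr M borel (P (Suc i))) borel (\<lambda>p. 6 * (influence p - theta)) = distr M borel (Z i)"
        unfolding Z_def by (subst distr_distr) (auto simp: comp_def intro: rv_P)
      then show ?thesis by (simp add: distr_P)
    qed
  qed
  have rvA: "random_variable borel (A n)" for n unfolding A_def by measurable
  have int_remainder: "integrable M (\<lambda>\<omega>. LINT s|unit_law. remainder n s \<omega>)" for n
    by (rule LM.integrable_snd[OF integrable_remainder])
  have rvB: "random_variable borel (B n)" for n
    unfolding B_def using rvA int_remainder by (intro borel_measurable_add borel_measurable_times) auto
  have "weak_conv_m (\<lambda>n. distr M borel (B n)) (normal_law 0 (W_footrule_avar C))"
  proof (rule weak_conv_m_cong_L1[OF rvA rvB _ conv])
    show "real_distribution (normal_law 0 (W_footrule_avar C))"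
      by (rule real_distribution_normal_law) (simp add: W_footrule_avar_eq)
    show "integrable M (\<lambda>\<omega>. B n \<omega> - A n \<omega>)" for n
      unfolding B_def using int_remainder by simp
    have "expectation (\<lambda>\<omega>. \<bar>B n \<omega> - A n \<omega>\<bar>) = 6 * expectation (\<lambda>\<omega>. \<bar>LINT s|unit_law. remainder n s \<omega>\<bar>)" for n
      unfolding B_def by (simp add: abs_mult)
    then show "(\<lambda>n. expectation (\<lambda>\<omega>. \<bar>B n \<omega> - A n \<omega>\<bar>)) \<longlonglongrightarrow> 0"
      using tendsto_mult_left[OF expectation_abs_integral_remainder_tendsto, of 6] by simp
  qed
  \<comment> \<open>The decomposition holds at every point of the space, so the laws coincide for
    each \<open>n\<close>.\<close>
  moreover have "distr M borel (B n) = distr M borel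
      (\<lambda>\<omega>. sqrt (real n) * (W_footrule_est (\<lambda>i. X i \<omega>) (\<lambda>i. Y i \<omega>) n - W_footrule C))" for n
    by (rule distr_cong) (auto simp: B_def A_def Z_def footrule_est_decomposition)
  ultimately show ?thesis by simp
qed

end

theorem theorem2:
  fixes M :: "'a measure"
    and X Y :: "nat \<Rightarrow> 'a \<Rightarrow> real"
    and D :: "(real \<times> real) measure"
    and C :: "real \<Rightarrow> real \<Rightarrow> real"
  assumes "prob_space M"
    and indep: "prob_space.indep_vars M (\<lambda>_. borel) (\<lambda>i \<omega>. (X i \<omega>, Y i \<omega>)) {1..}"
    and ident: "\<And>i. i \<ge> 1 \<Longrightarrow> distr M borel (\<lambda>\<omega>. (X i \<omega>, Y i \<omega>)) = D"
    and copula: "copula C"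
    and law: "continuous_law_with_copula D C"
    and partials: "has_continuous_partials C"
  shows "weak_conv_m
           (\<lambda>n. distr M borel
              (\<lambda>\<omega>. sqrt (real n) *
                 (W_footrule_est (\<lambda>i. X i \<omega>) (\<lambda>i. Y i \<omega>) n - W_footrule C)))
           (normal_law 0 (W_footrule_avar C))"
proof -
  interpret copula_sample M X Y D C
    by (intro copula_sample.intro copula_sample_axioms.intro) fact+
  show ?thesis by (rule asymptotic_normality)
qed

end
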